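(* Let $\Psi$ be an Orlicz function and $\phi\colon\mathbb D\to\mathbb D$ analytic. If $C_\phi\colon\mathscr B^\Psi\to\mathscr B^\Psi$ is compact, then $$\frac{\Psi^{-1}\big(1/(1-|\phi(a)|)^2\big)}{\Psi^{-1}\big(1/(1-|a|)^2\big)}\longrightarrow0\quad\text{as }|a|\to1^-.$$ Conversely, if $\Psi$ satisfies $\Delta^2$, this condition implies that $C_\phi\colon\mathscr B^\Psi\to\mathscr B^\Psi$ is compact.
   Context: An Orlicz function is a continuous, strictly convex, increasing $\Psi\colon[0,\infty)\to[0,\infty)$ with $\Psi(0)=0$ and $\Psi(x)/x\to\infty$. $d\mathscr A=dx\,dy/\pi$ is normalized area measure on $\mathbb D$. The Bergman–Orlicz space $\mathscr B^\Psi$ is the space of analytic $f$ on $\mathbb D$ belonging to $L^\Psi(\mathbb D,\mathscr A)$, with norm $\|f\|_\Psi=\inf\{C>0:\int_{\mathbb D}\Psi(|f|/C)\,d\mathscr A\le1\}$. $C_\phi f=f\circ\phi$ (bounded on $\mathscr B^\Psi$). $\Delta^2$: $\exists\alpha>1$, $\Psi(x)^2\le\Psi(\alpha x)$ for large $x$. *)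

theory Defs
  imports "HOL-Analysis.Analysis"
begin

definition orlicz_function :: "(real \<Rightarrow> real) \<Rightarrow> bool" where
  "orlicz_function \<Psi> \<longleftrightarrow>
     continuous_on {0..} \<Psi> \<and>
     (\<forall>x\<in>{0..}. \<forall>y\<in>{0..}. \<forall>t::real. x \<noteq> y \<and> 0 < t \<and> t < 1 \<longrightarrow>
         \<Psi> ((1 - t) * x + t * y) < (1 - t) * \<Psi> x + t * \<Psi> y) \<and>
     mono_on {0..} \<Psi> \<and>
     (\<forall>x\<in>{0..}. 0 \<le> \<Psi> x) \<and>
     \<Psi> 0 = 0 \<and>
     filterlim (\<lambda>x. \<Psi> x / x) at_top at_top"

definition orlicz_inv :: "(real \<Rightarrow> real) \<Rightarrow> real \<Rightarrow> real" where
  "orlicz_inv \<Psi> = the_inv_into {0..} \<Psi>"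

definition Delta2 :: "(real \<Rightarrow> real) \<Rightarrow> bool" where
  "Delta2 \<Psi> \<longleftrightarrow> (\<exists>\<alpha>>1. \<forall>\<^sub>F x in at_top. (\<Psi> x)\<^sup>2 \<le> \<Psi> (\<alpha> * x))"

definition disc_area :: "complex measure" where
  "disc_area = density (restrict_space lborel (ball 0 1)) (\<lambda>_. ennreal (1 / pi))"

definition orlicz_modular :: "(real \<Rightarrow> real) \<Rightarrow> (complex \<Rightarrow> complex) \<Rightarrow> ennreal" where
  "orlicz_modular \<Psi> f = (\<integral>\<^sup>+ z. ennreal (\<Psi> (norm (f z))) \<partial>disc_area)"

definition bergman_orlicz :: "(real \<Rightarrow> real) \<Rightarrow> (complex \<Rightarrow> complex) set" where
  "bergman_orlicz \<Psi> = {f. f holomorphic_on ball 0 1 \<and>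
      (\<exists>C>0. orlicz_modular \<Psi> (\<lambda>z. f z / of_real C) < \<infinity>)}"

definition orlicz_norm :: "(real \<Rightarrow> real) \<Rightarrow> (complex \<Rightarrow> complex) \<Rightarrow> real" where
  "orlicz_norm \<Psi> f = Inf {C. C > 0 \<and> orlicz_modular \<Psi> (\<lambda>z. f z / of_real C) \<le> 1}"

definition compact_composition :: "(real \<Rightarrow> real) \<Rightarrow> (complex \<Rightarrow> complex) \<Rightarrow> bool" where
  "compact_composition \<Psi> \<phi> \<longleftrightarrow>
     (\<forall>f :: nat \<Rightarrow> complex \<Rightarrow> complex.
        (\<forall>n. f n \<in> bergman_orlicz \<Psi>) \<and> (\<exists>M. \<forall>n. orlicz_norm \<Psi> (f n) \<le> M) \<longrightarrow>
        (\<exists>r g. strict_mono r \<and> g \<in> bergman_orlicz \<Psi> \<and>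
           (\<lambda>n. orlicz_norm \<Psi> (\<lambda>z. f (r n) (\<phi> z) - g z)) \<longlonglongrightarrow> 0))"

end

theory Submission
  imports Defs "HOL-Complex_Analysis.Complex_Analysis" "HOL-Real_Asymp.Real_Asymp"
begin

text \<open>
  Write \<open>H a = \<Psi>\<^sup>-\<^sup>1 (1 / (1 - |a|)\<^sup>2)\<close>. The area mean value property over the disc of centre \<open>a\<close> and
  radius \<open>1 - |a|\<close>, combined with Jensen's inequality, gives \<open>|f a| \<le> \<parallel>f\<parallel> H a\<close>.

  Necessity: for \<open>b = \<phi> a\<close> the functions \<open>H b ((1 - |b|) / (1 - cnj b z))\<^sup>4\<close> are bounded in norm, tend to
  \<open>0\<close> pointwise as \<open>|b| \<rightarrow> 1\<close>, and are at least \<open>H b / 16\<close> in modulus at \<open>b\<close>. By compactness a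
  subsequence of their compositions with \<open>\<phi>\<close> tends to \<open>0\<close> in norm, and the pointwise bound at \<open>a\<close>
  makes \<open>H (\<phi> a) / H a\<close> small.

  Sufficiency: applying \<open>\<Delta>\<^sup>2\<close> twice gives \<open>\<Psi> (H z / K) \<le> (1 - |z|) powr (-1/2)\<close> near the circle, which is
  integrable. If \<open>H \<circ> \<phi> = o(H)\<close>, then every multiple of \<open>H \<circ> \<phi>\<close> is eventually at most \<open>H / K\<close>, so
  Montel's theorem and dominated convergence apply.
\<close>

unbundle no fps_syntax

subsection \<open>The area mean value property\<close>

lemma emeasure_rotation_image_box:
  fixes l u w :: complex
  assumes w: "norm w = 1"
  shows "emeasure lborel ((\<lambda>z. w * z) ` box l u) = emeasure lborel (box l u)"
proof -
  \<comment> \<open>Orthogonal invariance of Lebesgue measure is in the library only for \<open>real^'n\<close>.\<close>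
  define T :: "complex \<Rightarrow> real^2" where "T = (\<lambda>z. vector [Re z, Im z])"
  define T' :: "real^2 \<Rightarrow> complex" where "T' = (\<lambda>v. Complex (v$1) (v$2))"
  have TT'[simp]: "T (T' v) = v" for v
    by (simp add: T_def T'_def vec_eq_iff forall_2 vector_2)
  have T'T[simp]: "T' (T z) = z" for z
    by (simp add: T_def T'_def complex_eq_iff)
  have linT: "linear T"
    by (rule linearI) (simp_all add: T_def vec_eq_iff forall_2 vector_2)
  have linT': "linear T'"
    by (rule linearI) (simp_all add: T'_def complex_eq_iff)
  have mT: "T \<in> borel_measurable borel"
    using linT linear_continuous_on[of T UNIV] by (auto simp: linear_linear intro!: borel_measurable_continuous_onI)
  have box: "T -` box a b = box (T' a) (T' b)" for a b
    by (auto simp: T_def T'_def box_def forall_2 vector_2 Basis_complex_def Basis_vec_def inner_axis)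
  \<comment> \<open>\<open>T\<close> carries Lebesgue measure of the plane to that of
    \<open>real^2\<close>: the preimage of a box is a box with the same side lengths, and boxes
    determine the measure.\<close>
  have D: "lborel = distr lborel borel T"
  proof (rule lborel_eqI)
    fix a b :: "real^2"
    assume ab: "\<And>c. c \<in> Basis \<Longrightarrow> a \<bullet> c \<le> b \<bullet> c"
    have le: "a$1 \<le> b$1" "a$2 \<le> b$2"
      using ab[of "axis 1 1"] ab[of "axis 2 1"] by (auto simp: inner_axis)
    have Bas: "(Basis :: (real^2) set) = {axis 1 1, axis 2 1}"
      by (auto simp: Basis_vec_def exhaust_2)(metis exhaust_2)
    have "axis 1 1 \<noteq> (axis 2 1 :: real^2)" by (simp add: axis_eq_axis)
    then have "(\<Prod>c\<in>Basis. (b - a) \<bullet> c) = (b$1 - a$1) * (b$2 - a$2)"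
      by (simp add: Bas inner_axis)
    moreover have "emeasure (distr lborel borel T) (box a b) = emeasure lborel (box (T' a) (T' b))"
      using mT by (subst emeasure_distr) (auto simp: box)
    moreover have "\<dots> = ennreal ((b$1 - a$1) * (b$2 - a$2))"
      using le by (subst emeasure_lborel_box) (auto simp: Basis_complex_def T'_def)
    ultimately show "emeasure (distr lborel borel T) (box a b) = ennreal (\<Prod>c\<in>Basis. (b - a) \<bullet> c)"
      by simp
  qed simp
  have E: "emeasure lborel (T -` A) = emeasure lborel A" if "A \<in> sets borel" for A
    using that mT by (subst D) (simp add: emeasure_distr)
  define R where "R = T \<circ> (\<lambda>z. w * z) \<circ> T'"
  have "linear (\<lambda>z. w * z)" by (rule linearI) (simp_all add: algebra_simps)
  then have linR: "linear R" unfolding R_def using linT linT' by (intro linear_compose)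
  have normT: "norm (T z) = norm z" for z
    by (simp add: norm_vec_def L2_set_def sum_2 T_def vector_2 cmod_def)
  have normT': "norm (T' z) = norm z" for z
    by (metis normT TT')
  have orth: "orthogonal_transformation R"
    unfolding orthogonal_transformation using linR by (simp add: R_def normT normT' norm_mult w)
  have injT: "T x = T y \<longleftrightarrow> x = y" for x y
    by (metis T'T)
  have Bq: "box (T l) (T u) = T ` box l u"
    using box[of "T l" "T u", symmetric] by (auto simp: image_iff) (metis TT')
  \<comment> \<open>Conjugating by \<open>T\<close> turns the rotation into the orthogonal map
    \<open>R\<close>, so the rotated box is the preimage of an \<open>R\<close>-image and
    \<open>E\<close> reduces its measure to that of the image.\<close>
  have Beq: "(\<lambda>z. w * z) ` box l u = T -` (R ` box (T l) (T u))"
    unfolding Bq R_def by (auto simp: injT image_iff)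
  have open_img: "open (R ` box (T l) (T u))"
    using orth orthogonal_transformation_surj orthogonal_transformation_linear
    by (intro open_surjective_linear_image) auto
  have "emeasure lborel ((\<lambda>z. w * z) ` box l u) = emeasure lborel (R ` box (T l) (T u))"
    unfolding Beq using open_img by (intro E) auto
  also have "\<dots> = emeasure lebesgue (R ` box (T l) (T u))"
    using open_img by simp
  also have "\<dots> = emeasure lebesgue (box (T l) (T u))"
    using measurable_orthogonal_image[OF orth, of "box (T l) (T u)"] measure_orthogonal_image[OF orth, of "box (T l) (T u)"]
    by (metis emeasure_eq_measure2 fmeasurableD2 lmeasurable_box emeasure_eq_ennreal_measure)
  also have "\<dots> = emeasure lborel (T -` box (T l) (T u))"
    by (subst E) auto
  also have "T -` box (T l) (T u) = box l u" by (simp add: box)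
  finally show ?thesis .
qed

text \<open>The preimage of a box under multiplication by \<open>w\<close> is its image under the
  inverse rotation \<open>cnj w\<close>, whose measure is known; boxes determine the whole
  measure.\<close>

lemma lborel_distr_rotation:
  fixes w :: complex
  assumes w: "norm w = 1"
  shows "distr lborel borel (\<lambda>z. w * z) = (lborel :: complex measure)"
proof (rule lborel_eqI[symmetric])
  fix l u :: complex
  assume lu: "\<And>b. b \<in> Basis \<Longrightarrow> l \<bullet> b \<le> u \<bullet> b"
  have w1: "cnj w * w = 1" using w by (simp add: complex_norm_square[symmetric] mult.commute)
  have "(\<lambda>z. w * z) -` box l u = (\<lambda>z. cnj w * z) ` box l u"
  proof (intro set_eqI iffI)
    fix z assume "z \<in> (\<lambda>z. w * z) -` box l u"
    moreover have "z = cnj w * (w * z)" by (simp add: w1 mult.assoc[symmetric])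
    ultimately show "z \<in> (\<lambda>z. cnj w * z) ` box l u" by blast
  next
    fix z assume "z \<in> (\<lambda>z. cnj w * z) ` box l u"
    then obtain y where y: "y \<in> box l u" "z = cnj w * y" by blast
    have "w * z = (cnj w * w) * y" unfolding y by (simp only: mult_ac)
    also have "\<dots> = y" by (simp only: w1 mult_1_left)
    finally show "z \<in> (\<lambda>z. w * z) -` box l u" using y by (simp only: vimage_eq)
  qed
  then have "emeasure (distr lborel borel (\<lambda>z. w * z)) (box l u) = emeasure lborel (box l u)"
    using emeasure_rotation_image_box[of "cnj w" l u] w
    by (subst emeasure_distr) auto
  then show "emeasure (distr lborel borel (\<lambda>z. w * z)) (box l u) = ennreal (\<Prod>b\<in>Basis. (u - l) \<bullet> b)"
    using lu by (simp add: emeasure_lborel_box)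
qed simp

lemma integral_ball_power_eq_0:
  fixes r :: real
  assumes n: "n > 0"
  shows "(LINT z:ball (0::complex) r|lborel. z ^ n) = 0"
proof -
  \<comment> \<open>The rotation by \<open>pi / n\<close> changes the sign of \<open>z ^ n\<close>.\<close>
  define w where "w = cis (pi / real n)"
  have w: "norm w = 1" by (simp add: w_def)
  have wn: "w ^ n = -1" using n by (simp add: w_def Complex.DeMoivre)
  have "(LINT z:ball 0 r|lborel. z ^ n)
      = (LINT z|distr lborel borel (\<lambda>z. w * z). indicator (ball 0 r) z *\<^sub>R z ^ n)"
    by (simp add: lborel_distr_rotation[OF w] set_lebesgue_integral_def)
  also have "\<dots> = (LINT z|lborel. indicator (ball 0 r) (w * z) *\<^sub>R (w * z) ^ n)"
    by (intro integral_distr borel_measurable_scaleR borel_measurable_indicator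
          borel_measurable_continuous_onI continuous_intros) auto
  also have "\<dots> = (LINT z|lborel. - (indicator (ball 0 r) z *\<^sub>R z ^ n))"
    by (rule Bochner_Integration.integral_cong) (auto simp: indicator_def norm_mult w power_mult_distrib wn)
  also have "\<dots> = - (LINT z:ball 0 r|lborel. z ^ n)"
    by (simp add: set_lebesgue_integral_def)
  finally show ?thesis by simp
qed

lemma emeasure_ball_complex: "r \<ge> 0 \<Longrightarrow> emeasure lborel (ball (c::complex) r) = ennreal (pi * r\<^sup>2)"
  by (subst emeasure_ball) (auto simp: unit_ball_vol_2)

lemma measure_ball_complex: "r \<ge> 0 \<Longrightarrow> measure lborel (ball (c::complex) r) = pi * r\<^sup>2"
  by (simp add: measure_def emeasure_ball_complex)

text \<open>Expand \<open>f\<close> in its power series at \<open>a\<close> and integrate term by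
  term: rotation symmetry kills every positive power, leaving the constant coefficient times the
  area. The slack \<open>r < R\<close> makes the series absolutely summable on the smaller
  ball.\<close>

lemma area_mean_value:
  fixes f :: "complex \<Rightarrow> complex"
  assumes f: "f holomorphic_on ball a R" and r: "0 < r" "r < R"
  shows "(LINT z:ball a r|lborel. f z) = of_real (pi * r\<^sup>2) * f a"
proof -
  define c where "c = (\<lambda>n. (deriv ^^ n) f a / fact n)"
  have sums: "(\<lambda>n. c n * z ^ n) sums f (a + z)" if "norm z < R" for z
    using holomorphic_power_series[OF f, of "a + z"] that by (simp add: c_def dist_norm)
  define g where "g = (\<lambda>n z. indicator (ball 0 r) z *\<^sub>R (c n * z ^ n))"
  have abs: "summable (\<lambda>n. norm (c n) * r ^ n)"
  proof -
    \<comment> \<open>Convergence at a radius strictly between \<open>r\<close> and \<open>R\<close>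
      forces absolute convergence at \<open>r\<close>.\<close>
    define s where "s = (r + R) / 2"
    have s: "r < s" "s < R" "0 < s" using r by (auto simp: s_def)
    have "summable (\<lambda>n. c n * of_real s ^ n)"
      using sums[of "of_real s"] s by (auto dest: sums_summable)
    then have "summable (\<lambda>n. norm (c n * of_real r ^ n))"
      by (rule powser_insidea) (use r s in auto)
    then show ?thesis using r by (simp add: norm_mult norm_power)
  qed
  have gb: "norm (g n z) \<le> indicator (ball 0 r) z * (norm (c n) * r ^ n)" for n z
    using r by (auto simp: g_def indicator_def norm_mult norm_power intro!: mult_left_mono power_mono)
  have gm[measurable]: "g n \<in> borel_measurable borel" for n
    unfolding g_def
    by (intro borel_measurable_scaleR borel_measurable_indicator borel_measurable_continuous_onI continuous_intros) auto
  have ib: "integrable lborel (\<lambda>z. indicator (ball (0::complex) r) z * (norm (c n) * r ^ n) :: real)" for n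
    using r by (intro integrable_mult_left) (auto simp: integrable_indicator_iff emeasure_ball_complex)
  have gi: "integrable lborel (g n)" for n
    by (rule Bochner_Integration.integrable_bound[OF ib[of n]]) (use gb r in auto)
  have "(LINT z|lborel. norm (g n z)) \<le> (LINT z|lborel. indicator (ball (0::complex) r) z * (norm (c n) * r ^ n))" for n
    by (rule integral_mono) (use gi ib gb in auto)
  also have "(LINT z|lborel. indicator (ball (0::complex) r) z * (norm (c n) * r ^ n)) = pi * r\<^sup>2 * (norm (c n) * r ^ n)" for n
    using r by (simp add: measure_ball_complex)
  finally have nb: "(LINT z|lborel. norm (g n z)) \<le> pi * r\<^sup>2 * (norm (c n) * r ^ n)" for n .
  have S: "(\<lambda>n. LINT z|lborel. g n z) sums (LINT z|lborel. (\<Sum>n. g n z))"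
  proof (rule sums_integral)
    show "integrable lborel (g n)" for n by fact
    have "summable (\<lambda>n. norm (g n z))" for z
    proof (rule summable_comparison_test'[OF abs, of 0])
      fix n
      show "norm (norm (g n z)) \<le> norm (c n) * r ^ n"
        using order_trans[OF gb[of n z], of "norm (c n) * r ^ n"] r by (simp add: indicator_def)
    qed
    then show "AE z in lborel. summable (\<lambda>n. norm (g n z))" by simp
    show "summable (\<lambda>n. LINT z|lborel. norm (g n z))"
      by (rule summable_comparison_test'[OF summable_mult[OF abs, of "pi * r\<^sup>2"], of 0]) (use nb in auto)
  qed
  have eq: "(\<Sum>n. g n z) = indicator (ball 0 r) z *\<^sub>R f (a + z)" for z
    using sums[of z] r by (auto simp: g_def indicator_def sums_iff)
  have g0: "(LINT z|lborel. g n z) = (if n = 0 then of_real (pi * r\<^sup>2) * f a else 0)" for n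
  proof (cases "n = 0")
    case True
    then show ?thesis using r by (simp add: g_def c_def measure_ball_complex scaleR_conv_of_real)
  next
    case False
    have "(LINT z|lborel. g n z) = (LINT z|lborel. c n * (indicator (ball 0 r) z *\<^sub>R z ^ n))"
      by (rule Bochner_Integration.integral_cong) (auto simp: g_def)
    also have "\<dots> = c n * (LINT z:ball 0 r|lborel. z ^ n)"
      by (simp only: set_lebesgue_integral_def integral_mult_right_zero)
    finally show ?thesis using False integral_ball_power_eq_0[of n r] by simp
  qed
  have "(LINT z|lborel. indicator (ball 0 r) z *\<^sub>R f (a + z)) = of_real (pi * r\<^sup>2) * f a"
    using S sums_single[of 0 "\<lambda>_. of_real (pi * r\<^sup>2) * f a"] unfolding g0 eq
    by (metis (no_types, lifting) sums_unique2 sums_cong)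
  moreover have "(LINT z|lborel. indicator (ball a r) z *\<^sub>R f z) = (LINT z|lborel. indicator (ball 0 r) z *\<^sub>R f (a + z))"
  proof -
    have "f holomorphic_on ball a r" using f r by (auto elim: holomorphic_on_subset)
    then have m: "(\<lambda>z. indicator (ball a r) z *\<^sub>R f z) \<in> borel_measurable borel"
      by (intro borel_measurable_continuous_on_indicator holomorphic_on_imp_continuous_on) auto
    have "(LINT z|lborel. indicator (ball a r) z *\<^sub>R f z)
        = (LINT z|distr lborel borel ((+) a). indicator (ball a r) z *\<^sub>R f z)"
      by (simp only: lborel_distr_plus)
    also have "\<dots> = (LINT z|lborel. indicator (ball a r) (a + z) *\<^sub>R f (a + z))"
      using m by (intro integral_distr) auto
    also have "\<dots> = (LINT z|lborel. indicator (ball 0 r) z *\<^sub>R f (a + z))"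
      by (intro Bochner_Integration.integral_cong) (auto simp: indicator_def dist_norm)
    finally show ?thesis .
  qed
  ultimately show ?thesis by (simp add: set_lebesgue_integral_def)
qed

subsection \<open>Orlicz functions and their inverses\<close>

locale orlicz =
  fixes \<Psi> :: "real \<Rightarrow> real"
  assumes orlicz: "orlicz_function \<Psi>"
begin

abbreviation "Inv \<equiv> orlicz_inv \<Psi>"

lemma zero [simp]: "\<Psi> 0 = 0"
  and nonneg: "0 \<le> x \<Longrightarrow> 0 \<le> \<Psi> x"
  and mono: "0 \<le> x \<Longrightarrow> x \<le> y \<Longrightarrow> \<Psi> x \<le> \<Psi> y"
  and cont: "continuous_on {0..} \<Psi>"
  and superlinear: "filterlim (\<lambda>x. \<Psi> x / x) at_top at_top"
  using orlicz unfolding orlicz_function_def mono_on_def by simp_all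

lemma strict_convex:
  "\<lbrakk>0 \<le> x; 0 \<le> y; x \<noteq> y; 0 < t; t < 1\<rbrakk>
    \<Longrightarrow> \<Psi> ((1 - t) * x + t * y) < (1 - t) * \<Psi> x + t * \<Psi> y"
  using orlicz unfolding orlicz_function_def by simp

lemma convex: "convex_on {0..} \<Psi>"
proof (rule convex_onI)
  fix t x y :: real
  assume *: "0 < t" "t < 1" "x \<in> {0..}" "y \<in> {0..}"
  show "\<Psi> ((1 - t) *\<^sub>R x + t *\<^sub>R y) \<le> (1 - t) * \<Psi> x + t * \<Psi> y"
  proof (cases "x = y")
    case True
    then show ?thesis by (simp add: algebra_simps)
  next
    case False
    then show ?thesis using strict_convex[of x y t] * by simp
  qed
qed simp

lemma scale_le:
  assumes "0 \<le> t" "t \<le> 1" "0 \<le> x"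
  shows "\<Psi> (t * x) \<le> t * \<Psi> x"
  using convex_onD[OF convex, of t 0 x] assms by simp

text \<open>Strict convexity at the midpoint of 0 and \<open>x\<close> puts the nonnegative value at
  \<open>x / 2\<close> strictly below half the value at \<open>x\<close>.\<close>

lemma pos:
  assumes x: "0 < x"
  shows "0 < \<Psi> x"
proof -
  have "\<Psi> ((1 - 1/2) * 0 + 1/2 * x) < (1 - 1/2) * \<Psi> 0 + 1/2 * \<Psi> x"
    using strict_convex[of 0 x "1/2"] x by simp
  moreover have "0 \<le> \<Psi> (1/2 * x)" using x by (intro nonneg) auto
  ultimately show ?thesis by simp
qed

text \<open>\<open>orlicz_function\<close> records only weak monotonicity. Strictness comes from
  convexity through the origin, which bounds \<open>\<Psi> x\<close> by
  \<open>x / y * \<Psi> y\<close>, and from positivity of \<open>\<Psi> y\<close>.\<close>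

lemma strict_mono:
  assumes "0 \<le> x" "x < y"
  shows "\<Psi> x < \<Psi> y"
proof -
  have "\<Psi> x \<le> x / y * \<Psi> y"
    using scale_le[of "x / y" y] assms by simp
  also have "\<dots> < \<Psi> y"
    using pos[of y] assms by (simp add: field_simps)
  finally show ?thesis .
qed

lemma le_iff: "0 \<le> x \<Longrightarrow> 0 \<le> y \<Longrightarrow> \<Psi> x \<le> \<Psi> y \<longleftrightarrow> x \<le> y"
  by (meson mono strict_mono linorder_not_less)

lemma inj: "inj_on \<Psi> {0..}"
  proof (rule inj_onI)
  fix x y assume "x \<in> {0..}" "y \<in> {0..}" "\<Psi> x = \<Psi> y"
  then show "x = y" using strict_mono[of x y] strict_mono[of y x] by (cases x y rule: linorder_cases) auto
qed

lemma eventually_ge_id: "\<forall>\<^sub>F x in at_top. x \<le> \<Psi> x"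
proof -
  have "\<forall>\<^sub>F x in at_top. 1 \<le> \<Psi> x / x"
    using superlinear by (simp add: filterlim_at_top)
  then show ?thesis
    using eventually_gt_at_top[of 0] by eventually_elim (simp add: field_simps)
qed

lemma image: "\<Psi> ` {0..} = {0..}"
proof
  show "\<Psi> ` {0..} \<subseteq> {0..}" using nonneg by auto
  show "{0..} \<subseteq> \<Psi> ` {0..}"
  proof
    fix y :: real assume y: "y \<in> {0..}"
    \<comment> \<open>Superlinear growth supplies an endpoint beyond \<open>y\<close> whose value is
      at least \<open>y\<close>, as the intermediate value theorem requires.\<close>
    obtain x where x: "x \<ge> y" "x \<le> \<Psi> x"
      using eventually_conj[OF eventually_ge_id eventually_ge_at_top[of y]]
      unfolding eventually_at_top_linorder by blast
    have "continuous_on {0..x} \<Psi>" by (rule continuous_on_subset[OF cont]) auto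
    then have "\<exists>z\<ge>0. z \<le> x \<and> \<Psi> z = y"
      using x y IVT'[of \<Psi> 0 y x] by auto
    then show "y \<in> \<Psi> ` {0..}" by auto
  qed
qed

lemma inv_nonneg: "0 \<le> y \<Longrightarrow> 0 \<le> Inv y"
  using the_inv_into_into[OF inj, of y "{0..}"] image unfolding orlicz_inv_def by auto

lemma inv_right [simp]: "0 \<le> y \<Longrightarrow> \<Psi> (Inv y) = y"
  using f_the_inv_into_f[OF inj, of y] image unfolding orlicz_inv_def by auto

lemma le_inv_iff: "0 \<le> x \<Longrightarrow> 0 \<le> y \<Longrightarrow> x \<le> Inv y \<longleftrightarrow> \<Psi> x \<le> y"
  using le_iff[of x "Inv y"] inv_nonneg[of y] by simp

lemma inv_mono: "0 \<le> x \<Longrightarrow> x \<le> y \<Longrightarrow> Inv x \<le> Inv y"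
  by (simp add: le_inv_iff inv_nonneg)

lemma inv_pos: "0 < y \<Longrightarrow> 0 < Inv y"
  using inv_right[of y] inv_nonneg[of y] by (cases "Inv y = 0") auto

lemma inv_at_top: "filterlim Inv at_top at_top"
  unfolding filterlim_at_top
proof
  fix Z :: real
  show "\<forall>\<^sub>F y in at_top. Z \<le> Inv y"
    using eventually_ge_at_top[of "\<Psi> (max 0 Z)"]
  proof eventually_elim
    case (elim y)
    then have "max 0 Z \<le> Inv y" using nonneg[of "max 0 Z"] by (subst le_inv_iff) auto
    then show ?case by simp
  qed
qed

text \<open>Since \<open>x \<le> \<Psi> x\<close> for large \<open>x\<close>, the inverse grows at
  most linearly. This crude growth bound is what makes the test functions vanish pointwise in the
  limit.\<close>

lemma inv_le_max: "\<exists>K\<ge>0. \<forall>y\<ge>0. Inv y \<le> max K y"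
proof -
  obtain K where K: "\<And>x. x \<ge> K \<Longrightarrow> x \<le> \<Psi> x"
    using eventually_ge_id unfolding eventually_at_top_linorder by blast
  have "Inv y \<le> max (max 0 K) y" if "y \<ge> 0" for y
    using K[of "Inv y"] that by (cases "Inv y \<ge> K") auto
  then show ?thesis by (intro exI[of _ "max 0 K"]) auto
qed

text \<open>This is the tool for Jensen's inequality. A nonnegative slope matters because the mean
  value property bounds the average of \<open>norm (f z)\<close> only from below. The endpoint 0 is
  treated apart, as it is not interior.\<close>

lemma support_line:
  assumes x: "0 \<le> x"
  shows "\<exists>m\<ge>0. \<forall>y\<ge>0. \<Psi> x + m * (y - x) \<le> \<Psi> y"
proof (cases "x = 0")
  case True
  then show ?thesis by (auto intro!: exI[of _ 0] nonneg)
next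
  case False
  \<comment> \<open>The right derivative at \<open>x\<close>, written as the infimum of the
    difference quotients to the right.\<close>
  define m where "m = Inf ((\<lambda>t. (\<Psi> x - \<Psi> t) / (x - t)) ` ({x<..} \<inter> {0..}))"
  have "x \<in> interior {0..}" using False x by simp
  then have L: "\<Psi> x + m * (y - x) \<le> \<Psi> y" if "y \<ge> 0" for y
    using convex_le_Inf_differential[OF convex, of x y] that by (auto simp: m_def)
  \<comment> \<open>A negative slope would put the supporting line above \<open>\<Psi>\<close> at
    the origin.\<close>
  moreover have "m \<ge> 0"
  proof (rule ccontr)
    assume "\<not> m \<ge> 0"
    then have "m * (0 - x) > 0" using x False by (simp add: mult_neg_pos)
    then show False using L[of 0] pos[of x] x False by simp
  qed
  ultimately show ?thesis by auto
qed

end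

subsection \<open>The modular, the norm and the pointwise bound\<close>

lemma space_disc_area [simp]: "space disc_area = ball 0 1"
  by (simp add: disc_area_def space_restrict_space)

lemma measurable_disc_area:
  fixes f :: "complex \<Rightarrow> 'a::topological_space"
  assumes "continuous_on (ball 0 1) f"
  shows "f \<in> borel_measurable disc_area"
  using borel_measurable_continuous_on_restrict[OF assms] unfolding disc_area_def
  by (simp add: measurable_def space_restrict_space sets_restrict_space)

lemma nn_integral_disc_area:
  assumes F: "F \<in> borel_measurable disc_area"
  shows "(\<integral>\<^sup>+ z. F z \<partial>disc_area) = ennreal (1 / pi) * (\<integral>\<^sup>+ z. F z * indicator (ball 0 1) z \<partial>lborel)"
proof -
  have "F \<in> borel_measurable (restrict_space lborel (ball 0 1))"
    using F by (simp add: disc_area_def)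
  then show ?thesis
    unfolding disc_area_def
    by (simp add: nn_integral_density nn_integral_cmult nn_integral_restrict_space)
qed

lemma emeasure_disc_area:
  assumes "A \<in> sets borel" "A \<subseteq> ball 0 1"
  shows "emeasure disc_area A = ennreal (1 / pi) * emeasure lborel A"
proof -
  have A: "A \<in> sets disc_area"
    using assms by (auto simp: disc_area_def sets_restrict_space image_iff intro!: bexI[of _ A])
  have "emeasure disc_area A = (\<integral>\<^sup>+ z. indicator A z \<partial>disc_area)"
    using A by simp
  also have "\<dots> = ennreal (1 / pi) * (\<integral>\<^sup>+ z. indicator A z * indicator (ball 0 1) z \<partial>lborel)"
    using A by (intro nn_integral_disc_area) auto
  also have "(\<lambda>z. indicator A z * indicator (ball 0 1) z :: ennreal) = indicator A"
    using assms(2) by (auto simp: indicator_def fun_eq_iff)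
  finally show ?thesis using assms by simp
qed

lemma emeasure_disc_area_ball:
  assumes "0 \<le> r" "r \<le> 1"
  shows "emeasure disc_area (ball 0 r) = ennreal (r\<^sup>2)"
proof -
  have "emeasure disc_area (ball 0 r) = ennreal (1 / pi) * ennreal (pi * r\<^sup>2)"
    using assms by (subst emeasure_disc_area) (auto simp: emeasure_ball_complex)
  also have "\<dots> = ennreal (r\<^sup>2)" by (simp flip: ennreal_mult)
  finally show ?thesis .
qed

section \<open>Modular, Luxemburg norm and point evaluations\<close>

context orlicz
begin

lemma measurable_modular:
  assumes "continuous_on (ball 0 1) f"
  shows "(\<lambda>z. ennreal (\<Psi> (norm (f z)))) \<in> borel_measurable disc_area"
  by (intro measurable_compose[OF measurable_disc_area measurable_ennreal]
      continuous_intros continuous_on_compose2[OF cont] assms) auto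

lemma modular_mono:
  assumes "\<And>z. z \<in> ball 0 1 \<Longrightarrow> norm (f z) \<le> norm (g z)"
  shows "orlicz_modular \<Psi> f \<le> orlicz_modular \<Psi> g"
  unfolding orlicz_modular_def by (intro nn_integral_mono ennreal_leI mono) (use assms in auto)

lemma modular_le_const:
  assumes "\<And>z. z \<in> ball 0 1 \<Longrightarrow> norm (f z) \<le> B"
  shows "orlicz_modular \<Psi> f \<le> ennreal (\<Psi> B)"
proof -
  have "orlicz_modular \<Psi> f \<le> (\<integral>\<^sup>+ z. ennreal (\<Psi> B) \<partial>disc_area)"
    unfolding orlicz_modular_def by (intro nn_integral_mono ennreal_leI mono) (use assms in auto)
  also have "\<dots> = ennreal (\<Psi> B)"
    using emeasure_disc_area_ball[of 1] by simp
  finally show ?thesis .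
qed

lemma modular_scale:
  assumes f: "continuous_on (ball 0 1) f" and t: "0 \<le> t" "t \<le> 1"
  shows "orlicz_modular \<Psi> (\<lambda>z. of_real t * f z) \<le> ennreal t * orlicz_modular \<Psi> f"
proof -
  have "orlicz_modular \<Psi> (\<lambda>z. of_real t * f z) \<le> (\<integral>\<^sup>+ z. ennreal t * ennreal (\<Psi> (norm (f z))) \<partial>disc_area)"
    unfolding orlicz_modular_def
    by (intro nn_integral_mono) (use t in \<open>auto simp: norm_mult nonneg ennreal_leI scale_le simp flip: ennreal_mult\<close>)
  also have "\<dots> = ennreal t * orlicz_modular \<Psi> f"
    unfolding orlicz_modular_def by (intro nn_integral_cmult measurable_modular f)
  finally show ?thesis .
qed

lemma norm_le:
  assumes "C > 0" "orlicz_modular \<Psi> (\<lambda>z. f z / of_real C) \<le> 1"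
  shows "orlicz_norm \<Psi> f \<le> C"
  unfolding orlicz_norm_def by (rule cInf_lower) (use assms in \<open>auto intro!: bdd_belowI[of _ 0]\<close>)

text \<open>Without \<open>finite_norm f\<close>, the value of \<open>orlicz_norm \<Psi> f\<close> is the unspecified \<open>Inf {}\<close>.\<close>

definition finite_norm :: "(complex \<Rightarrow> complex) \<Rightarrow> bool" where
  "finite_norm f \<longleftrightarrow> (\<exists>C>0. orlicz_modular \<Psi> (\<lambda>z. f z / of_real C) \<le> 1)"

text \<open>A finite modular drops to at most 1 once \<open>C\<close> is enlarged by a suitable
  factor, by \<open>modular_scale\<close>. Hence membership in the space says exactly that the
  infimum defining the norm runs over a nonempty set.\<close>

lemma finite_norm_iff:
  assumes f: "continuous_on (ball 0 1) f"
  shows "finite_norm f \<longleftrightarrow> (\<exists>C>0. orlicz_modular \<Psi> (\<lambda>z. f z / of_real C) < \<infinity>)"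
proof
  assume "finite_norm f"
  then obtain C where "C > 0" "orlicz_modular \<Psi> (\<lambda>z. f z / of_real C) \<le> 1"
    unfolding finite_norm_def by blast
  then show "\<exists>C>0. orlicz_modular \<Psi> (\<lambda>z. f z / of_real C) < \<infinity>"
    by (intro exI[of _ C]) (auto simp: order_le_less_trans)
next
  assume "\<exists>C>0. orlicz_modular \<Psi> (\<lambda>z. f z / of_real C) < \<infinity>"
  then obtain C where C: "C > 0" "orlicz_modular \<Psi> (\<lambda>z. f z / of_real C) < \<infinity>" by blast
  obtain m where m: "0 \<le> m" "orlicz_modular \<Psi> (\<lambda>z. f z / of_real C) = ennreal m"
    using C(2) by (cases "orlicz_modular \<Psi> (\<lambda>z. f z / of_real C)") auto
  \<comment> \<open>The factor is at least 1, so \<open>1 / k\<close> is an admissible scale, and at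
    least \<open>m\<close>, so the scaled modular is at most 1.\<close>
  define k where "k = max 1 m"
  have k: "k \<ge> 1" "k \<ge> m" by (auto simp: k_def)
  have "orlicz_modular \<Psi> (\<lambda>z. of_real (1 / k) * (f z / of_real C)) \<le> ennreal (1 / k) * ennreal m"
    unfolding m(2)[symmetric] using k C by (intro modular_scale continuous_intros f) auto
  also have "\<dots> \<le> 1" using k m by (simp add: ennreal_le_1 flip: ennreal_mult)
  finally show "finite_norm f"
    unfolding finite_norm_def using C k by (intro exI[of _ "k * C"]) auto
qed

lemma mem_bergman_iff: "f \<in> bergman_orlicz \<Psi> \<longleftrightarrow> f holomorphic_on ball 0 1 \<and> finite_norm f"
  unfolding bergman_orlicz_def using finite_norm_iff holomorphic_on_imp_continuous_on by blast

lemma norm_nonneg: "finite_norm f \<Longrightarrow> 0 \<le> orlicz_norm \<Psi> f"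
  unfolding orlicz_norm_def finite_norm_def by (rule cInf_greatest) auto

text \<open>The admissible constants form an upward closed set, so everything strictly above the
  infimum is admissible. Strictness avoids deciding whether the infimum is attained.\<close>

lemma norm_less:
  assumes "finite_norm f" "orlicz_norm \<Psi> f < C"
  shows "0 < C" and "orlicz_modular \<Psi> (\<lambda>z. f z / of_real C) \<le> 1"
proof -
  obtain C' where C': "0 < C'" "C' < C" "orlicz_modular \<Psi> (\<lambda>z. f z / of_real C') \<le> 1"
  proof -
    have "{C. C > 0 \<and> orlicz_modular \<Psi> (\<lambda>z. f z / of_real C) \<le> 1} \<noteq> {}"
      using assms(1) by (auto simp: finite_norm_def)
    from cInf_lessD[OF this] assms(2) show ?thesis
      using that unfolding orlicz_norm_def by blast
  qed
  have "orlicz_modular \<Psi> (\<lambda>z. f z / of_real C) \<le> orlicz_modular \<Psi> (\<lambda>z. f z / of_real C')"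
    by (intro modular_mono) (use C' in \<open>auto simp: norm_divide intro!: divide_left_mono\<close>)
  then show "orlicz_modular \<Psi> (\<lambda>z. f z / of_real C) \<le> 1" using C' by simp
  show "0 < C" using C' by simp
qed

lemma finite_norm_bounded:
  assumes "continuous_on (ball 0 1) f" "\<And>z. z \<in> ball 0 1 \<Longrightarrow> norm (f z) \<le> B"
  shows "finite_norm f"
  unfolding finite_norm_iff[OF assms(1)]
  using modular_le_const[of f B] assms(2) by (intro exI[of _ 1]) (auto simp: order_le_less_trans)

text \<open>Only finiteness is at stake, so no triangle inequality is proved: the scaled difference
  is at most the larger of the two scaled moduli, and \<open>\<Psi>\<close> of a maximum is at most
  the sum of the two values. The resulting finite modular suffices by
  \<open>finite_norm_iff\<close>.\<close>

lemma finite_norm_diff: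
  assumes f: "continuous_on (ball 0 1) f" "finite_norm f"
      and g: "continuous_on (ball 0 1) g" "finite_norm g"
  shows "finite_norm (\<lambda>z. f z - g z)"
proof -
  obtain C1 C2 where C: "0 < C1" "orlicz_modular \<Psi> (\<lambda>z. f z / of_real C1) \<le> 1"
    "0 < C2" "orlicz_modular \<Psi> (\<lambda>z. g z / of_real C2) \<le> 1"
    using f g unfolding finite_norm_def by blast
  define C where "C = C1 + C2"
  have pt: "\<Psi> (norm ((f z - g z) / of_real C)) \<le> \<Psi> (norm (f z / of_real C1)) + \<Psi> (norm (g z / of_real C2))" for z
  proof -
    define M where "M = max (norm (f z) / C1) (norm (g z) / C2)"
    have "norm (f z) \<le> M * C1" "norm (g z) \<le> M * C2"
      using C by (auto simp: M_def simp flip: pos_divide_le_eq)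
    then have "norm (f z - g z) \<le> M * C"
      using norm_triangle_ineq4[of "f z" "g z"] by (simp add: C_def algebra_simps)
    then have "norm (f z - g z) / C \<le> M" using C by (simp add: pos_divide_le_eq C_def)
    then have "\<Psi> (norm (f z - g z) / C) \<le> \<Psi> M" by (intro mono) (use C in \<open>auto simp: C_def\<close>)
    also have "\<dots> \<le> \<Psi> (norm (f z) / C1) + \<Psi> (norm (g z) / C2)"
      using C nonneg[of "norm (f z) / C1"] nonneg[of "norm (g z) / C2"] by (auto simp: M_def max_def)
    finally show ?thesis using C by (simp add: norm_divide C_def del: of_real_add)
  qed
  have "orlicz_modular \<Psi> (\<lambda>z. (f z - g z) / of_real C)
      \<le> (\<integral>\<^sup>+ z. ennreal (\<Psi> (norm (f z / of_real C1))) + ennreal (\<Psi> (norm (g z / of_real C2))) \<partial>disc_area)"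
    unfolding orlicz_modular_def
    by (intro nn_integral_mono) (use pt in \<open>auto simp: nonneg ennreal_leI simp flip: ennreal_plus\<close>)
  also have "\<dots> = orlicz_modular \<Psi> (\<lambda>z. f z / of_real C1) + orlicz_modular \<Psi> (\<lambda>z. g z / of_real C2)"
    unfolding orlicz_modular_def using C
    by (intro nn_integral_add measurable_modular continuous_intros f g) auto
  also have "\<dots> < \<infinity>" using C by (auto simp: order_le_less_trans)
  finally show ?thesis using C f g
    by (subst finite_norm_iff) (auto intro!: continuous_intros exI[of _ C] simp: C_def)
qed

text \<open>Jensen's inequality by hand: take the supporting line of \<open>\<Psi>\<close> at
  \<open>norm (f a)\<close>, evaluate it at \<open>norm (f z)\<close>, and integrate over the disc
  of radius \<open>r\<close>. Keeping \<open>r\<close> below \<open>1 - norm a\<close> leaves a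
  compact closed disc inside the unit disc, so every integrand is integrable.\<close>

lemma sub_mean_value:
  assumes f: "f holomorphic_on ball 0 1" and a: "norm a < 1" and r: "0 < r" "r < 1 - norm a"
  shows "ennreal (r\<^sup>2 * \<Psi> (norm (f a))) \<le> orlicz_modular \<Psi> f"
proof -
  have sub: "cball a r \<subseteq> ball 0 1"
    using r by (auto simp: dist_norm subset_eq) (smt (verit) norm_triangle_sub norm_minus_commute)
  have sub': "ball a (1 - norm a) \<subseteq> ball 0 1"
    by (auto simp: dist_norm subset_eq) (smt (verit) norm_triangle_sub norm_minus_commute)
  have sub2: "ball a r \<subseteq> ball 0 1" using sub ball_subset_cball by blast
  have fc: "continuous_on (ball 0 1) f" using f by (rule holomorphic_on_imp_continuous_on)
  define x where "x = norm (f a)"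
  obtain m where m: "m \<ge> 0" "\<And>y. y \<ge> 0 \<Longrightarrow> \<Psi> x + m * (y - x) \<le> \<Psi> y"
    using support_line[of x] by (auto simp: x_def)
  have int: "set_integrable lborel (ball a r) h" if "continuous_on (ball 0 1) h" for h :: "complex \<Rightarrow> 'b::{banach, second_countable_topology}"
  proof -
    have "set_integrable lborel (cball a r) h"
      using that sub unfolding set_integrable_def
      by (intro borel_integrable_compact) (auto intro: continuous_on_subset)
    then show ?thesis by (rule set_integrable_subset) auto
  qed
  have int1: "set_integrable lborel (ball a r) f" by (intro int fc)
  have int2: "set_integrable lborel (ball a r) (\<lambda>z. norm (f z))" by (intro int continuous_intros fc)
  have int3: "set_integrable lborel (ball a r) (\<lambda>z. \<Psi> (norm (f z)))"
    by (intro int continuous_on_compose2[OF cont] continuous_intros fc) auto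
  have int4: "set_integrable lborel (ball a r) (\<lambda>z. c::real)" for c
    by (intro int continuous_intros)
  have const: "(LINT z:ball a r|lborel. c) = pi * r\<^sup>2 * c" for c :: real
    using r by (simp add: set_lebesgue_integral_def measure_ball_complex)
  have "pi * r\<^sup>2 * x = norm (LINT z:ball a r|lborel. f z)"
    using r a by (subst area_mean_value[OF holomorphic_on_subset[OF f sub']]) (auto simp: norm_mult norm_power x_def)
  also have "\<dots> \<le> (LINT z:ball a r|lborel. norm (f z))"
    using int1 by (rule set_integral_norm_bound)
  finally have mean: "pi * r\<^sup>2 * x \<le> (LINT z:ball a r|lborel. norm (f z))" .
  \<comment> \<open>The added term is nonnegative by the mean value inequality and
    \<open>m \<ge> 0\<close>; it turns the constant into the integral of the supporting
    line.\<close>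
  have "pi * r\<^sup>2 * \<Psi> x \<le> pi * r\<^sup>2 * \<Psi> x + m * ((LINT z:ball a r|lborel. norm (f z)) - pi * r\<^sup>2 * x)"
    using m mean by simp
  also have "\<dots> = (LINT z:ball a r|lborel. (\<Psi> x - m * x) + m * norm (f z))"
    using int2 by (subst set_integral_add(2)) (auto intro: int4 simp: const algebra_simps)
  also have "\<dots> \<le> (LINT z:ball a r|lborel. \<Psi> (norm (f z)))"
    using m(2)[of "norm (f _)"] by (intro set_integral_mono set_integral_add int4 set_integrable_mult_right int2 int3)
      (auto simp: algebra_simps)
  finally have "ennreal (pi * r\<^sup>2 * \<Psi> x) \<le> ennreal (LINT z:ball a r|lborel. \<Psi> (norm (f z)))"
    by (rule ennreal_leI)
  also have "\<dots> = (\<integral>\<^sup>+ z. ennreal (indicator (ball a r) z *\<^sub>R \<Psi> (norm (f z))) \<partial>lborel)"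
    unfolding set_lebesgue_integral_def
    using int3[unfolded set_integrable_def] by (intro nn_integral_eq_integral[symmetric]) (auto simp: nonneg)
  also have "\<dots> \<le> (\<integral>\<^sup>+ z. ennreal (\<Psi> (norm (f z))) * indicator (ball 0 1) z \<partial>lborel)"
    by (intro nn_integral_mono)
      (auto dest!: subsetD[OF sub2] simp del: mem_ball split: split_indicator)
  finally have "ennreal (1 / pi) * ennreal (pi * r\<^sup>2 * \<Psi> x)
      \<le> ennreal (1 / pi) * (\<integral>\<^sup>+ z. ennreal (\<Psi> (norm (f z))) * indicator (ball 0 1) z \<partial>lborel)"
    by (rule mult_left_mono) simp
  also have "\<dots> = orlicz_modular \<Psi> f"
    unfolding orlicz_modular_def by (intro nn_integral_disc_area[symmetric] measurable_modular fc)
  finally show ?thesis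
    by (simp add: x_def nonneg flip: ennreal_mult)
qed

text \<open>Apply \<open>sub_mean_value\<close> to \<open>f / C\<close> and let the radius increase
  to \<open>1 - norm a\<close>; then invert \<open>\<Psi>\<close>.\<close>

lemma pointwise_bound:
  assumes f: "f holomorphic_on ball 0 1" and a: "norm a < 1"
    and C: "C > 0" "orlicz_modular \<Psi> (\<lambda>z. f z / of_real C) \<le> 1"
  shows "norm (f a) \<le> C * Inv (1 / (1 - norm a)\<^sup>2)"
proof -
  define y where "y = \<Psi> (norm (f a / of_real C))"
  have "r\<^sup>2 * y \<le> 1" if "0 < r" "r < 1 - norm a" for r
  proof -
    have "ennreal (r\<^sup>2 * y) \<le> 1"
      unfolding y_def using that C f a
      by (intro order_trans[OF sub_mean_value C(2)] holomorphic_intros) auto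
    then show ?thesis by (simp add: ennreal_le_1)
  qed
  moreover have "((\<lambda>r. r\<^sup>2 * y) \<longlongrightarrow> (1 - norm a)\<^sup>2 * y) (at_left (1 - norm a))"
    by (intro tendsto_intros)
  moreover have "\<forall>\<^sub>F r in at_left (1 - norm a). 0 < r \<and> r < 1 - norm a"
    using a eventually_at_left_real[of 0 "1 - norm a"] by auto
  ultimately have "(1 - norm a)\<^sup>2 * y \<le> 1"
    by (intro tendsto_upperbound) (auto elim: eventually_mono)
  then have "y \<le> 1 / (1 - norm a)\<^sup>2"
    using a by (simp add: field_simps)
  then have "norm (f a / of_real C) \<le> Inv (1 / (1 - norm a)\<^sup>2)"
    unfolding y_def by (subst le_inv_iff) auto
  then show ?thesis using C by (simp add: norm_divide field_simps)
qed

text \<open>The bound holds for every \<open>C\<close> above the norm, and \<open>C\<close> then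
  decreases to the norm.\<close>

lemma pointwise_norm_bound:
  assumes f: "f holomorphic_on ball 0 1" "finite_norm f" and a: "norm a < 1"
  shows "norm (f a) \<le> orlicz_norm \<Psi> f * Inv (1 / (1 - norm a)\<^sup>2)"
proof -
  have "norm (f a) \<le> C * Inv (1 / (1 - norm a)\<^sup>2)" if "orlicz_norm \<Psi> f < C" for C
    using norm_less[OF f(2) that] by (intro pointwise_bound f a)
  moreover have "((\<lambda>C. C * Inv (1 / (1 - norm a)\<^sup>2)) \<longlongrightarrow> orlicz_norm \<Psi> f * Inv (1 / (1 - norm a)\<^sup>2))
      (at_right (orlicz_norm \<Psi> f))"
    by (intro tendsto_intros)
  ultimately show ?thesis
    by (intro tendsto_lowerbound) (auto simp: eventually_at_right_less elim!: eventually_mono[OF eventually_at_right_less])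
qed

end

subsection \<open>Two dyadic estimates\<close>

lemma geometric_bracket:
  fixes q x :: real
  assumes "0 < q" "q < 1" "0 < x" "x \<le> 1"
  shows "\<exists>k. q ^ Suc k < x \<and> x \<le> q ^ k"
proof -
  obtain n where n: "q ^ n < x" using real_arch_pow_inv[of x q] assms by auto
  define k where "k = (LEAST n. q ^ n < x)"
  have k: "q ^ k < x" unfolding k_def using n by (rule LeastI)
  \<comment> \<open>The least exponent is not 0 because \<open>x \<le> 1\<close>, so it has a
    predecessor, which gives the upper bound.\<close>
  then obtain j where j: "k = Suc j" using assms by (cases k) auto
  have "\<not> q ^ j < x" using not_less_Least[of j "\<lambda>n. q ^ n < x"] j by (auto simp: k_def)
  then show ?thesis using k j by auto
qed

text \<open>The sets only have to cover the space, not to be disjoint: pointwise, \<open>F\<close>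
  is below one term of the series of weighted indicators, hence below its sum.\<close>

lemma nn_integral_le_sums:
  fixes c m :: "nat \<Rightarrow> real"
  assumes A: "\<And>k. A k \<in> sets M" and c: "\<And>k. 0 \<le> c k" and m: "\<And>k. 0 \<le> m k"
    and mA: "\<And>k. emeasure M (A k) \<le> ennreal (m k)"
    and F: "\<And>z. z \<in> space M \<Longrightarrow> \<exists>k. z \<in> A k \<and> F z \<le> ennreal (c k)"
    and s: "(\<lambda>k. c k * m k) sums s"
  shows "(\<integral>\<^sup>+ z. F z \<partial>M) \<le> ennreal s"
proof -
  have "(\<integral>\<^sup>+ z. F z \<partial>M) \<le> (\<integral>\<^sup>+ z. (\<Sum>k. ennreal (c k) * indicator (A k) z) \<partial>M)"
  proof (rule nn_integral_mono)
    fix z assume "z \<in> space M"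
    then obtain k where k: "z \<in> A k" "F z \<le> ennreal (c k)" using F by blast
    have "F z \<le> (\<Sum>j\<in>{k}. ennreal (c j) * indicator (A j) z)" using k by simp
    also have "\<dots> \<le> (\<Sum>k. ennreal (c k) * indicator (A k) z)"
      by (rule sum_le_suminf) auto
    finally show "F z \<le> (\<Sum>k. ennreal (c k) * indicator (A k) z)" .
  qed
  also have "\<dots> = (\<Sum>k. \<integral>\<^sup>+ z. ennreal (c k) * indicator (A k) z \<partial>M)"
    using A by (intro nn_integral_suminf) auto
  also have "\<dots> = (\<Sum>k. ennreal (c k) * emeasure M (A k))"
    using A by (simp add: nn_integral_cmult_indicator)
  also have "\<dots> \<le> (\<Sum>k. ennreal (c k * m k))"
    using c m mA by (intro suminf_le) (auto simp: ennreal_mult intro!: mult_left_mono)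
  also have "\<dots> = ennreal s"
    using s c m by (subst suminf_ennreal2) (auto simp: sums_iff)
  finally show ?thesis .
qed

text \<open>Where \<open>1 - norm z\<close> lies between consecutive powers of \<open>1/4\<close>,
  the integrand is at most \<open>2 * 2 ^ k\<close>, while the collar \<open>A k\<close> has
  normalized area at most \<open>2 * (1/4) ^ k\<close>. The products are
  \<open>4 * (1/2) ^ k\<close>, with sum 8.\<close>

lemma nn_integral_inverse_sqrt_disc:
  "(\<integral>\<^sup>+ z. ennreal (1 / sqrt (1 - norm z)) \<partial>disc_area) < \<infinity>"
proof -
  define A where "A k = ball 0 1 - ball (0::complex) (1 - (1/4) ^ k)" for k :: nat
  have Ab: "ball (0::complex) r \<in> sets disc_area" if "r \<le> 1" for r
    using that by (auto simp: disc_area_def sets_restrict_space image_iff intro!: bexI[of _ "ball 0 r"])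
  have "(\<integral>\<^sup>+ z. ennreal (1 / sqrt (1 - norm z)) \<partial>disc_area) \<le> ennreal 8"
  proof (rule nn_integral_le_sums[where A = A and c = "\<lambda>k. 2 * 2 ^ k" and m = "\<lambda>k. 2 * (1/4) ^ k"])
    show "A k \<in> sets disc_area" for k
      unfolding A_def by (intro sets.Diff Ab) auto
    show "emeasure disc_area (A k) \<le> ennreal (2 * (1/4) ^ k)" for k
    proof -
      define q :: real where "q = (1/4) ^ k"
      have q: "0 < q" "q \<le> 1" by (auto simp: q_def power_le_one)
      have "emeasure disc_area (A k) = emeasure disc_area (ball 0 1) - emeasure disc_area (ball 0 (1 - q))"
        unfolding A_def q_def[symmetric] using q
        by (intro emeasure_Diff Ab) (auto simp: emeasure_disc_area_ball)
      also have "\<dots> = ennreal (1 - (1 - q)\<^sup>2)"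
        using q by (simp add: emeasure_disc_area_ball ennreal_minus flip: ennreal_1)
      also have "\<dots> \<le> ennreal (2 * q)"
        by (intro ennreal_leI) (simp add: power2_eq_square algebra_simps)
      finally show ?thesis by (simp add: q_def)
    qed
    fix z assume "z \<in> space disc_area"
    then have z: "norm z < 1" by simp
    obtain k where k: "(1/4) ^ Suc k < 1 - norm z" "1 - norm z \<le> (1/4::real) ^ k"
      using geometric_bracket[of "1/4" "1 - norm z"] z by auto
    have "(1 / (2 * 2 ^ k))\<^sup>2 \<le> 1 - norm z"
      using k(1) by (simp add: power2_eq_square power_divide flip: power_mult_distrib)
    then have "1 / (2 * 2 ^ k) \<le> sqrt (1 - norm z)"
      by (rule real_le_rsqrt)
    then have "1 / sqrt (1 - norm z) \<le> 2 * 2 ^ k"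
      using z by (simp add: field_simps)
    then show "\<exists>k. z \<in> A k \<and> ennreal (1 / sqrt (1 - norm z)) \<le> ennreal (2 * 2 ^ k)"
      using k z by (intro exI[of _ k]) (auto simp: A_def intro!: ennreal_leI)
  next
    have "(\<lambda>k. 4 * (1/2) ^ k) sums (4 * (1 / (1 - 1/2 :: real)))"
      by (intro sums_mult geometric_sums) auto
    moreover have "(2 * 2 ^ k * (2 * (1/4) ^ k) :: real) = 4 * (1/2) ^ k" for k
    proof -
      have "(2 ^ k * (1/4) ^ k :: real) = (1/2) ^ k" by (simp flip: power_mult_distrib)
      then show ?thesis by simp
    qed
    ultimately show "(\<lambda>k. 2 * 2 ^ k * (2 * (1/4) ^ k)) sums (8::real)" by simp
  qed auto
  then show ?thesis by (simp add: order_le_less_trans)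
qed

lemma one_minus_mult_bounds:
  fixes b z :: complex
  assumes "norm b < 1" "norm z < 1"
  shows "1 - norm b \<le> norm (1 - cnj b * z)" and "1 - cnj b * z \<noteq> 0"
proof -
  have "norm (cnj b * z) \<le> norm b"
    using assms by (simp add: norm_mult mult_left_le)
  then show le: "1 - norm b \<le> norm (1 - cnj b * z)"
    using norm_triangle_ineq2[of 1 "cnj b * z"] by simp
  show "1 - cnj b * z \<noteq> 0" using le assms by auto
qed

text \<open>The denominator is \<open>norm b\<close> times the distance from \<open>z\<close> to
  \<open>1 / cnj b\<close>. With \<open>d = 1 - norm b\<close>, points where the quotient lies
  between \<open>(1/2) ^ Suc k\<close> and \<open>(1/2) ^ k\<close> are within
  \<open>4 * 2 ^ k * d\<close> of that centre, one factor 2 coming from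
  \<open>1/2 \<le> norm b\<close>. Fourth powers \<open>(1/16) ^ k\<close> against areas
  \<open>16 * 4 ^ k * d\<^sup>2\<close> sum to \<open>64/3 * d\<^sup>2\<close>.\<close>

lemma nn_integral_kernel_le:
  fixes b :: complex
  assumes b: "1/2 \<le> norm b" "norm b < 1"
  shows "(\<integral>\<^sup>+ z. ennreal (((1 - norm b) / norm (1 - cnj b * z)) ^ 4) \<partial>disc_area)
    \<le> ennreal (22 * (1 - norm b)\<^sup>2)"
proof -
  define d where "d = 1 - norm b"
  have d: "d > 0" using b by (simp add: d_def)
  define A where "A k = ball (1 / cnj b) (4 * 2 ^ k * d) \<inter> ball 0 1" for k :: nat
  have "(\<integral>\<^sup>+ z. ennreal ((d / norm (1 - cnj b * z)) ^ 4) \<partial>disc_area) \<le> ennreal (64/3 * d\<^sup>2)"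
  proof (rule nn_integral_le_sums[where A = A and c = "\<lambda>k. (1/16) ^ k" and m = "\<lambda>k. 16 * 4 ^ k * d\<^sup>2"])
    show "A k \<in> sets disc_area" for k
      unfolding A_def disc_area_def by (auto simp: sets_restrict_space image_iff intro!: bexI[of _ "A k"] simp: A_def)
    show "emeasure disc_area (A k) \<le> ennreal (16 * 4 ^ k * d\<^sup>2)" for k
    proof -
      have "emeasure disc_area (A k) = ennreal (1 / pi) * emeasure lborel (A k)"
        by (intro emeasure_disc_area) (auto simp: A_def)
      also have "\<dots> \<le> ennreal (1 / pi) * emeasure lborel (ball (1 / cnj b) (4 * 2 ^ k * d))"
        by (intro mult_left_mono emeasure_mono) (auto simp: A_def)
      also have "\<dots> = ennreal (1 / pi) * ennreal (pi * (4 * 2 ^ k * d)\<^sup>2)"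
        using d by (subst emeasure_ball_complex) auto
      also have "\<dots> = ennreal ((4 * 2 ^ k * d)\<^sup>2)"
        by (simp flip: ennreal_mult)
      also have "(4 * 2 ^ k * d)\<^sup>2 = 16 * 4 ^ k * d\<^sup>2"
        by (simp add: power_mult_distrib power2_eq_square flip: power_mult_distrib[of _ _ k])
      finally show ?thesis .
    qed
    fix z assume "z \<in> space disc_area"
    then have z: "norm z < 1" by simp
    define w where "w = norm (1 - cnj b * z)"
    have w: "d \<le> w" "w > 0"
      using one_minus_mult_bounds[of b z] b z d by (auto simp: w_def d_def)
    obtain k where k: "(1/2) ^ Suc k < d / w" "d / w \<le> (1/2::real) ^ k"
      using geometric_bracket[of "1/2" "d / w"] w d by auto
    have "w < 2 * 2 ^ k * d" using k(1) w by (simp add: field_simps)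
    moreover have "norm (1 / cnj b - z) = w / norm b"
    proof -
      have "norm b > 0" using b by linarith
      then have "1 / cnj b - z = (1 - cnj b * z) / cnj b" by (simp add: diff_divide_distrib)
      then show ?thesis by (simp add: w_def norm_divide)
    qed
    moreover have "w / norm b \<le> 2 * w"
    proof (subst pos_divide_le_eq)
      show "0 < norm b" using b by linarith
      show "w \<le> 2 * w * norm b" using mult_left_mono[of 1 "2 * norm b" w] b w by simp
    qed
    ultimately have "z \<in> A k" using z by (simp add: A_def dist_norm)
    moreover have "(d / w) ^ 4 \<le> (1/16) ^ k"
    proof -
      have "(d / w) ^ 4 \<le> ((1/2) ^ k) ^ 4" using k(2) w d by (intro power_mono) auto
      also have "\<dots> = (1/16) ^ k" by (simp add: power_mult[symmetric] mult.commute[of k]) (simp add: power_mult power_divide)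
      finally show ?thesis .
    qed
    ultimately show "\<exists>k. z \<in> A k \<and> ennreal ((d / norm (1 - cnj b * z)) ^ 4) \<le> ennreal ((1/16) ^ k)"
      by (intro exI[of _ k]) (auto simp: w_def intro!: ennreal_leI)
  next
    have S: "(\<lambda>k. 16 * d\<^sup>2 * (1/4) ^ k) sums (16 * d\<^sup>2 * (1 / (1 - 1/4 :: real)))"
      by (intro sums_mult geometric_sums) auto
    have eq: "((1/16) ^ k * (16 * 4 ^ k * d\<^sup>2) :: real) = 16 * d\<^sup>2 * (1/4) ^ k" for k
    proof -
      have "((1/16) ^ k * 4 ^ k :: real) = (1/4) ^ k" by (simp flip: power_mult_distrib)
      then show ?thesis by simp
    qed
    show "(\<lambda>k. (1/16) ^ k * (16 * 4 ^ k * d\<^sup>2)) sums (64/3 * d\<^sup>2)"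
      unfolding eq using S by simp
  qed auto
  also have "\<dots> \<le> ennreal (22 * d\<^sup>2)" by (intro ennreal_leI) simp
  finally show ?thesis by (simp add: d_def)
qed

subsection \<open>Sufficiency\<close>

abbreviation near_circle :: "complex filter" where
  "near_circle \<equiv> filtercomap norm (at_left 1)"

lemma eventually_near_circle:
  "eventually P near_circle \<longleftrightarrow> (\<exists>s<1. \<forall>a. s < norm a \<and> norm a < 1 \<longrightarrow> P a)"
  unfolding eventually_filtercomap
proof safe
  fix Q :: "real \<Rightarrow> bool" assume "eventually Q (at_left 1)" "\<forall>x::complex. Q (norm x) \<longrightarrow> P x"
  then show "\<exists>s<1. \<forall>a. s < norm a \<and> norm a < 1 \<longrightarrow> P a"
    unfolding eventually_at_left[OF zero_less_one] by blast
next
  fix s :: real assume "s < 1" "\<forall>a. s < norm a \<and> norm a < 1 \<longrightarrow> P a"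
  then show "\<exists>Q. eventually Q (at_left (1::real)) \<and> (\<forall>x. Q (norm x) \<longrightarrow> P x)"
    unfolding eventually_at_left[OF zero_less_one]
    by (intro exI[of _ "\<lambda>t. s < t \<and> t < 1"]) auto
qed

lemma filterlim_inverse_square_near_circle:
  "filterlim (\<lambda>a::complex. 1 / (1 - norm a)\<^sup>2) at_top near_circle"
proof -
  have "filterlim (\<lambda>t::real. 1 / (1 - t)\<^sup>2) at_top (at_left 1)" by real_asymp
  then show ?thesis by (rule filterlim_compose) (rule filterlim_filtercomap)
qed

section \<open>The growth condition near the circle\<close>

context orlicz
begin

text \<open>The condition is used at \<open>x / \<alpha>\<close> and at
  \<open>x / \<alpha>\<^sup>2\<close>. One use would only lead to \<open>1 / (1 - norm a)\<close>,
  which is not integrable over the disc; the fourth power leads to its square root.\<close>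

lemma Delta2_iterate:
  assumes "Delta2 \<Psi>"
  shows "\<exists>K>0. \<forall>\<^sub>F x in at_top. \<Psi> (x / K) ^ 4 \<le> \<Psi> x"
proof -
  obtain \<alpha> where \<alpha>: "\<alpha> > 1" "\<forall>\<^sub>F x in at_top. (\<Psi> x)\<^sup>2 \<le> \<Psi> (\<alpha> * x)"
    using assms unfolding Delta2_def by blast
  have lim: "filterlim (\<lambda>x. x / c) at_top at_top" if "c > 0" for c :: real
    using that by real_asymp
  have "\<forall>\<^sub>F x in at_top. (\<Psi> (x / \<alpha>))\<^sup>2 \<le> \<Psi> (\<alpha> * (x / \<alpha>))"
    using lim[of \<alpha>] \<alpha> by (intro eventually_compose_filterlim[OF \<alpha>(2)]) auto
  moreover have "\<forall>\<^sub>F x in at_top. (\<Psi> (x / \<alpha>\<^sup>2))\<^sup>2 \<le> \<Psi> (\<alpha> * (x / \<alpha>\<^sup>2))"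
    using lim[of "\<alpha>\<^sup>2"] \<alpha> by (intro eventually_compose_filterlim[OF \<alpha>(2)]) auto
  ultimately have "\<forall>\<^sub>F x in at_top. \<Psi> (x / \<alpha>\<^sup>2) ^ 4 \<le> \<Psi> x"
  proof eventually_elim
    case (elim x)
    have "((\<Psi> (x / \<alpha>\<^sup>2))\<^sup>2)\<^sup>2 \<le> (\<Psi> (x / \<alpha>))\<^sup>2"
      using elim(2) \<alpha> by (intro power_mono) (auto simp: power2_eq_square)
    also have "\<dots> \<le> \<Psi> x" using elim(1) \<alpha> by simp
    finally show ?case by simp
  qed
  then show ?thesis using \<alpha> by (intro exI[of _ "\<alpha>\<^sup>2"]) auto
qed

text \<open>Put \<open>x = Inv (1 / (1 - norm a)\<^sup>2)\<close>, which tends to infinity at the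
  circle, and take fourth roots of \<open>\<Psi> x = 1 / (1 - norm a)\<^sup>2\<close>.\<close>

lemma Delta2_inv_near_circle:
  assumes "Delta2 \<Psi>"
  shows "\<exists>K>0. \<forall>\<^sub>F a::complex in near_circle.
    \<Psi> (Inv (1 / (1 - norm a)\<^sup>2) / K) \<le> 1 / sqrt (1 - norm a)"
proof -
  obtain K where K: "K > 0" "\<forall>\<^sub>F x in at_top. \<Psi> (x / K) ^ 4 \<le> \<Psi> x"
    using Delta2_iterate[OF assms] by blast
  have "\<forall>\<^sub>F a::complex in near_circle.
      \<Psi> (Inv (1 / (1 - norm a)\<^sup>2) / K) ^ 4 \<le> \<Psi> (Inv (1 / (1 - norm a)\<^sup>2))"
    by (intro eventually_compose_filterlim[OF K(2)] filterlim_compose[OF inv_at_top]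
        filterlim_inverse_square_near_circle)
  moreover have "\<forall>\<^sub>F a::complex in near_circle. norm a < 1"
    unfolding eventually_near_circle by (intro exI[of _ 0]) auto
  ultimately have "\<forall>\<^sub>F a::complex in near_circle.
    \<Psi> (Inv (1 / (1 - norm a)\<^sup>2) / K) \<le> 1 / sqrt (1 - norm a)"
  proof eventually_elim
    case (elim a)
    define y where "y = \<Psi> (Inv (1 / (1 - norm a)\<^sup>2) / K)"
    have "(1 / sqrt (1 - norm a)) ^ 4 = ((1 / sqrt (1 - norm a))\<^sup>2)\<^sup>2" by simp
    also have "\<dots> = 1 / (1 - norm a)\<^sup>2" using elim by (simp add: power_divide)
    finally have "y ^ 4 \<le> (1 / sqrt (1 - norm a)) ^ 4" using elim by (simp add: y_def)
    moreover have "0 \<le> y" unfolding y_def using K elim by (intro nonneg divide_nonneg_pos inv_nonneg) auto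
    ultimately have "y \<le> 1 / sqrt (1 - norm a)"
      using elim by (subst (asm) power_mono_iff) auto
    then show ?case by (simp add: y_def)
  qed
  then show ?thesis using K by blast
qed

end

text \<open>The norm attains its maximum on a nonempty compact set. The empty set must be covered
  because the radius supplied by \<open>eventually_near_circle\<close> may be negative.\<close>

lemma compact_disc_radius:
  assumes "compact (S :: complex set)" "S \<subseteq> ball 0 1"
  shows "\<exists>s<1. \<forall>z\<in>S. norm z \<le> s"
proof (cases "S = {}")
  case False
  obtain x where "x \<in> S" "\<And>y. y \<in> S \<Longrightarrow> norm y \<le> norm x"
    using continuous_attains_sup[OF assms(1) False, of norm] by (auto intro: continuous_intros)
  then show ?thesis using assms(2) by (intro exI[of _ "norm x"]) auto
qed (auto intro: exI[of _ 0])

section \<open>Domination, normal families and compactness\<close>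

context orlicz
begin

lemma inverse_square_pos: "norm (a :: complex) < 1 \<Longrightarrow> 0 < 1 / (1 - norm a)\<^sup>2"
  by simp

lemma inv_disc_mono:
  "s \<le> t \<Longrightarrow> t < 1 \<Longrightarrow> Inv (1 / (1 - s)\<^sup>2) \<le> Inv (1 / (1 - t)\<^sup>2)"
  by (intro inv_mono divide_left_mono power_mono) auto

text \<open>Near the circle the limit hypothesis reduces the claim to the integrable inverse square
  root. On the remaining closed disc, \<open>\<phi>\<close> has relatively small values and a
  constant suffices. The factor \<open>c\<close> is arbitrary because the norm is tested by dividing
  by arbitrarily small constants.\<close>

lemma dominating_function:
  assumes \<phi>: "\<phi> holomorphic_on ball 0 1" "\<phi> ` ball 0 1 \<subseteq> ball 0 1"
    and D2: "Delta2 \<Psi>"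
    and lim: "((\<lambda>a. Inv (1 / (1 - norm (\<phi> a))\<^sup>2) / Inv (1 / (1 - norm a)\<^sup>2)) \<longlongrightarrow> 0) near_circle"
    and c: "0 < c"
  shows "\<exists>w \<in> borel_measurable disc_area. (\<integral>\<^sup>+ z. w z \<partial>disc_area) < \<infinity> \<and>
    (\<forall>z\<in>ball 0 1. ennreal (\<Psi> (c * Inv (1 / (1 - norm (\<phi> z))\<^sup>2))) \<le> w z)"
proof -
  obtain K where K: "K > 0" "\<forall>\<^sub>F a::complex in near_circle.
      \<Psi> (Inv (1 / (1 - norm a)\<^sup>2) / K) \<le> 1 / sqrt (1 - norm a)"
    using Delta2_inv_near_circle[OF D2] by blast
  \<comment> \<open>The threshold \<open>1 / (c * K)\<close> absorbs both the factor
    \<open>c\<close> and the loss \<open>K\<close> from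
    \<open>Delta2_inv_near_circle\<close>.\<close>
  have "\<forall>\<^sub>F a in near_circle. Inv (1 / (1 - norm (\<phi> a))\<^sup>2) / Inv (1 / (1 - norm a)\<^sup>2) < 1 / (c * K)"
    by (rule order_tendstoD[OF lim]) (use c K in auto)
  from eventually_conj[OF this K(2)] obtain s where s: "s < 1"
    and s1: "\<And>a. s < norm a \<Longrightarrow> norm a < 1 \<Longrightarrow>
        Inv (1 / (1 - norm (\<phi> a))\<^sup>2) / Inv (1 / (1 - norm a)\<^sup>2) < 1 / (c * K)"
    and s2: "\<And>a. s < norm (a::complex) \<Longrightarrow> norm a < 1 \<Longrightarrow>
        \<Psi> (Inv (1 / (1 - norm a)\<^sup>2) / K) \<le> 1 / sqrt (1 - norm a)"
    unfolding eventually_near_circle by blast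
  have sub: "cball 0 s \<subseteq> ball (0::complex) 1" using s by auto
  have "compact (\<phi> ` cball 0 s)"
    by (intro compact_continuous_image compact_cball
        continuous_on_subset[OF holomorphic_on_imp_continuous_on[OF \<phi>(1)] sub])
  moreover have "\<phi> ` cball 0 s \<subseteq> ball 0 1" using sub \<phi>(2) by blast
  ultimately obtain t where t: "t < 1" "\<And>z. z \<in> cball 0 s \<Longrightarrow> norm (\<phi> z) \<le> t"
    using compact_disc_radius[of "\<phi> ` cball 0 s"] by auto
  define B where "B = \<Psi> (c * Inv (1 / (1 - t)\<^sup>2))"
  define w where "w z = ennreal B + ennreal (1 / sqrt (1 - norm z))" for z :: complex
  have B: "B \<ge> 0" unfolding B_def using c by (intro nonneg mult_nonneg_nonneg inv_nonneg) auto
  have [measurable]: "(\<lambda>z::complex. ennreal (1 / sqrt (1 - norm z))) \<in> borel_measurable disc_area"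
    by (intro measurable_compose[OF measurable_disc_area measurable_ennreal] continuous_intros) auto
  have w: "w \<in> borel_measurable disc_area" unfolding w_def by measurable
  have "(\<integral>\<^sup>+ z. w z \<partial>disc_area) = ennreal B + (\<integral>\<^sup>+ z. ennreal (1 / sqrt (1 - norm z)) \<partial>disc_area)"
    unfolding w_def using emeasure_disc_area_ball[of 1] by (subst nn_integral_add) auto
  also have "\<dots> < \<infinity>" using nn_integral_inverse_sqrt_disc by simp
  finally have wfin: "(\<integral>\<^sup>+ z. w z \<partial>disc_area) < \<infinity>" .
  have "ennreal (\<Psi> (c * Inv (1 / (1 - norm (\<phi> z))\<^sup>2))) \<le> w z" if z: "z \<in> ball 0 1" for z
  proof (cases "norm z \<le> s")
    case True
    have \<phi>1: "norm (\<phi> z) < 1" using z \<phi>(2) by (auto simp: image_subset_iff)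
    have "\<Psi> (c * Inv (1 / (1 - norm (\<phi> z))\<^sup>2)) \<le> B" unfolding B_def
      using c True t \<phi>1 by (intro mono mult_left_mono inv_disc_mono mult_nonneg_nonneg inv_nonneg) auto
    then have "ennreal (\<Psi> (c * Inv (1 / (1 - norm (\<phi> z))\<^sup>2))) \<le> ennreal B" by (rule ennreal_leI)
    then show ?thesis unfolding w_def by (simp add: add_increasing2)
  next
    case False
    have z1: "norm z < 1" using z by simp
    have "c * Inv (1 / (1 - norm (\<phi> z))\<^sup>2) \<le> Inv (1 / (1 - norm z)\<^sup>2) / K"
      using s1[of z] False z1 c K inv_pos[OF inverse_square_pos[OF z1]] by (simp add: field_simps)
    then have "\<Psi> (c * Inv (1 / (1 - norm (\<phi> z))\<^sup>2)) \<le> \<Psi> (Inv (1 / (1 - norm z)\<^sup>2) / K)"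
      using c by (intro mono mult_nonneg_nonneg inv_nonneg) auto
    also have "\<dots> \<le> 1 / sqrt (1 - norm z)" using s2[of z] False z1 by simp
    finally have "ennreal (\<Psi> (c * Inv (1 / (1 - norm (\<phi> z))\<^sup>2))) \<le> ennreal (1 / sqrt (1 - norm z))"
      by (rule ennreal_leI)
    then show ?thesis unfolding w_def by (simp add: add_increasing)
  qed
  then show ?thesis using w wfin by blast
qed

text \<open>Bounded point evaluations make the sequence locally uniformly bounded, so Montel's
  theorem applies, and the same bound passes to the limit. It is the bound on \<open>g\<close>,
  rather than membership of \<open>g\<close>, that controls \<open>g\<close> composed with
  \<open>\<phi>\<close> later.\<close>

lemma normal_family_limit:
  fixes f :: "nat \<Rightarrow> complex \<Rightarrow> complex"
  assumes f: "\<And>n. f n \<in> bergman_orlicz \<Psi>" and M: "\<And>n. orlicz_norm \<Psi> (f n) < C"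
  obtains g r where "g holomorphic_on ball 0 1" "strict_mono (r :: nat \<Rightarrow> nat)"
    "\<And>z. z \<in> ball 0 1 \<Longrightarrow> (\<lambda>n. f (r n) z) \<longlonglongrightarrow> g z"
    "\<And>z n. z \<in> ball 0 1 \<Longrightarrow> norm (f (r n) z) \<le> C * Inv (1 / (1 - norm z)\<^sup>2)"
    "\<And>z. z \<in> ball 0 1 \<Longrightarrow> norm (g z) \<le> C * Inv (1 / (1 - norm z)\<^sup>2)"
proof -
  have hol: "f n holomorphic_on ball 0 1" and fin: "finite_norm (f n)" for n
    using f by (auto simp: mem_bergman_iff)
  have C: "C > 0" using norm_less(1)[OF fin M] .
  have bd: "norm (f n z) \<le> C * Inv (1 / (1 - norm z)\<^sup>2)" if "z \<in> ball 0 1" for n z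
    using that norm_less[OF fin M] by (intro pointwise_bound hol) auto
  obtain g r where gr: "g holomorphic_on ball 0 1" "strict_mono (r :: nat \<Rightarrow> nat)"
    "\<And>z. z \<in> ball 0 1 \<Longrightarrow> (\<lambda>n. f (r n) z) \<longlonglongrightarrow> g z"
  proof (rule Montel[of "ball 0 1" "range f" f])
    fix K :: "complex set" assume K: "compact K" "K \<subseteq> ball 0 1"
    then obtain s where s: "s < 1" "\<And>z. z \<in> K \<Longrightarrow> norm z \<le> s"
      using compact_disc_radius[OF K] by auto
    have "norm (f n z) \<le> C * Inv (1 / (1 - s)\<^sup>2)" if z: "z \<in> K" for n z
    proof -
      have "norm (f n z) \<le> C * Inv (1 / (1 - norm z)\<^sup>2)" using bd z K by blast
      also have "\<dots> \<le> C * Inv (1 / (1 - s)\<^sup>2)" using C s z by (intro mult_left_mono inv_disc_mono) auto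
      finally show ?thesis .
    qed
    then show "\<exists>B. \<forall>h\<in>range f. \<forall>z\<in>K. norm (h z) \<le> B" by blast
  qed (use hol in auto)
  have "norm (g z) \<le> C * Inv (1 / (1 - norm z)\<^sup>2)" if "z \<in> ball 0 1" for z
    using bd that by (intro tendsto_upperbound[OF tendsto_norm[OF gr(3)[OF that]]]) auto
  note gbd = this
  show ?thesis
  proof (rule that)
    show "g holomorphic_on ball 0 1" "strict_mono r" by fact+
    show "(\<lambda>n. f (r n) z) \<longlonglongrightarrow> g z" if "z \<in> ball 0 1" for z using that by (rule gr(3))
    show "norm (f (r n) z) \<le> C * Inv (1 / (1 - norm z)\<^sup>2)" if "z \<in> ball 0 1" for z n using that by (rule bd)
    show "norm (g z) \<le> C * Inv (1 / (1 - norm z)\<^sup>2)" if "z \<in> ball 0 1" for z using that by (rule gbd)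
  qed
qed

lemma compact_composition_if:
  assumes \<phi>: "\<phi> holomorphic_on ball 0 1" "\<phi> ` ball 0 1 \<subseteq> ball 0 1"
    and D2: "Delta2 \<Psi>"
    and lim: "((\<lambda>a. Inv (1 / (1 - norm (\<phi> a))\<^sup>2) / Inv (1 / (1 - norm a)\<^sup>2)) \<longlongrightarrow> 0) near_circle"
  shows "compact_composition \<Psi> \<phi>"
  unfolding compact_composition_def
proof (intro allI impI, elim conjE exE)
  fix f :: "nat \<Rightarrow> complex \<Rightarrow> complex" and M
  assume f: "\<forall>n. f n \<in> bergman_orlicz \<Psi>" and M: "\<forall>n. orlicz_norm \<Psi> (f n) \<le> M"
  \<comment> \<open>\<open>norm_less\<close> needs a strict bound, hence
    \<open>M + 1\<close>.\<close>
  have M1: "orlicz_norm \<Psi> (f n) < M + 1" for n using M[rule_format, of n] by simp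
  have C: "M + 1 > 0" using f norm_less(1)[OF _ M1, of 0] by (auto simp: mem_bergman_iff)
  define H where "H = (\<lambda>z::complex. Inv (1 / (1 - norm z)\<^sup>2))"
  obtain g r where gr: "g holomorphic_on ball 0 1" "strict_mono (r :: nat \<Rightarrow> nat)"
    "\<And>z. z \<in> ball 0 1 \<Longrightarrow> (\<lambda>n. f (r n) z) \<longlonglongrightarrow> g z"
    and fb: "\<And>z n. z \<in> ball 0 1 \<Longrightarrow> norm (f (r n) z) \<le> (M + 1) * H z"
    and gb: "\<And>z. z \<in> ball 0 1 \<Longrightarrow> norm (g z) \<le> (M + 1) * H z"
    using normal_family_limit[of f "M + 1"] f M1 unfolding H_def by metis
  have \<phi>in: "\<phi> z \<in> ball 0 1" if "z \<in> ball 0 1" for z using that \<phi>(2) by blast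
  have comp: "(\<lambda>z. h (\<phi> z)) holomorphic_on ball 0 1" if "h holomorphic_on ball 0 1" for h
    using holomorphic_on_compose_gen[OF \<phi>(1) that \<phi>(2)] by (simp add: o_def)
  have fhol: "f n holomorphic_on ball 0 1" for n using f by (simp add: mem_bergman_iff)
  have "finite_norm (\<lambda>z. g (\<phi> z))"
  proof -
    obtain w where w: "(\<integral>\<^sup>+ z. w z \<partial>disc_area) < \<infinity>"
      "\<And>z. z \<in> ball 0 1 \<Longrightarrow> ennreal (\<Psi> ((M + 1) * H (\<phi> z))) \<le> w z"
      using dominating_function[OF \<phi> D2 lim C] unfolding H_def by blast
    have "orlicz_modular \<Psi> (\<lambda>z. g (\<phi> z)) \<le> (\<integral>\<^sup>+ z. w z \<partial>disc_area)"
      unfolding orlicz_modular_def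
    proof (rule nn_integral_mono)
      fix z assume "z \<in> space disc_area"
      then have z: "z \<in> ball 0 1" by simp
      have "ennreal (\<Psi> (norm (g (\<phi> z)))) \<le> ennreal (\<Psi> ((M + 1) * H (\<phi> z)))"
        by (intro ennreal_leI mono gb \<phi>in z) auto
      then show "ennreal (\<Psi> (norm (g (\<phi> z)))) \<le> w z" using w(2)[OF z] by (rule order_trans)
    qed
    then have "orlicz_modular \<Psi> (\<lambda>z. g (\<phi> z) / of_real 1) < \<infinity>" using w(1) by simp
    then show ?thesis
      using finite_norm_iff[OF holomorphic_on_imp_continuous_on[OF comp[OF gr(1)]]] zero_less_one by blast
  qed
  then have "(\<lambda>z. g (\<phi> z)) \<in> bergman_orlicz \<Psi>" using comp[OF gr(1)] by (simp add: mem_bergman_iff)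
  moreover have "(\<lambda>n. orlicz_norm \<Psi> (\<lambda>z. f (r n) (\<phi> z) - g (\<phi> z))) \<longlonglongrightarrow> 0"
  proof (rule LIMSEQ_I)
    fix \<epsilon> :: real assume \<epsilon>: "\<epsilon> > 0"
    \<comment> \<open>Half of \<open>\<epsilon>\<close>, because a modular at most 1 yields only the
      weak bound by \<open>\<delta>\<close>.\<close>
    define \<delta> where "\<delta> = \<epsilon> / 2"
    have \<delta>: "\<delta> > 0" "\<delta> < \<epsilon>" using \<epsilon> by (auto simp: \<delta>_def)
    define u where "u n z = norm ((f (r n) (\<phi> z) - g (\<phi> z)) / of_real \<delta>)" for n z
    have uc: "continuous_on (ball 0 1) (\<lambda>z. (f (r n) (\<phi> z) - g (\<phi> z)) / of_real \<delta>)" for n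
      using \<delta> by (intro holomorphic_on_imp_continuous_on holomorphic_intros comp fhol gr) auto
    \<comment> \<open>Both \<open>f (r n)\<close> and \<open>g\<close> are bounded by
      \<open>(M + 1) * H\<close>, so their difference divided by \<open>\<delta>\<close> is bounded
      by \<open>c * H\<close>.\<close>
    define c where "c = 2 * (M + 1) / \<delta>"
    have c: "c > 0" using C \<delta> by (simp add: c_def)
    obtain w where w: "w \<in> borel_measurable disc_area" "(\<integral>\<^sup>+ z. w z \<partial>disc_area) < \<infinity>"
      "\<And>z. z \<in> ball 0 1 \<Longrightarrow> ennreal (\<Psi> (c * H (\<phi> z))) \<le> w z"
      using dominating_function[OF \<phi> D2 lim c] unfolding H_def by blast
    have "(\<lambda>n. \<integral>\<^sup>+ z. ennreal (\<Psi> (u n z)) \<partial>disc_area) \<longlonglongrightarrow> (\<integral>\<^sup>+ z. 0 \<partial>(disc_area :: complex measure))"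
    proof (rule nn_integral_dominated_convergence[OF _ _ w(1) _ w(2)])
      show "(\<lambda>z. ennreal (\<Psi> (u n z))) \<in> borel_measurable disc_area" for n
        unfolding u_def by (rule measurable_modular[OF uc])
      show "AE z in disc_area. ennreal (\<Psi> (u n z)) \<le> w z" for n
      proof (rule AE_I2)
        fix z assume "z \<in> space disc_area"
        then have z: "z \<in> ball 0 1" by simp
        have "norm (f (r n) (\<phi> z) - g (\<phi> z)) \<le> 2 * (M + 1) * H (\<phi> z)"
          using norm_triangle_ineq4[of "f (r n) (\<phi> z)" "g (\<phi> z)"] fb[OF \<phi>in[OF z], of n] gb[OF \<phi>in[OF z]]
          by (simp add: algebra_simps)
        then have "u n z \<le> c * H (\<phi> z)"
          using \<delta> by (simp add: u_def c_def norm_divide divide_right_mono)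
        then have "ennreal (\<Psi> (u n z)) \<le> ennreal (\<Psi> (c * H (\<phi> z)))"
          by (intro ennreal_leI mono) (auto simp: u_def)
        then show "ennreal (\<Psi> (u n z)) \<le> w z" using w(3)[OF z] by (rule order_trans)
      qed
      show "AE z in disc_area. (\<lambda>n. ennreal (\<Psi> (u n z))) \<longlonglongrightarrow> 0"
      proof (rule AE_I2)
        fix z assume "z \<in> space disc_area"
        then have z: "z \<in> ball 0 1" by simp
        have "(\<lambda>n. u n z) \<longlonglongrightarrow> norm ((g (\<phi> z) - g (\<phi> z)) / of_real \<delta>)"
          unfolding u_def using \<delta> by (intro tendsto_intros gr(3) \<phi>in z) auto
        then have "(\<lambda>n. u n z) \<longlonglongrightarrow> 0" by simp
        then have "(\<lambda>n. \<Psi> (u n z)) \<longlonglongrightarrow> \<Psi> 0"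
          by (intro continuous_on_tendsto_compose[OF cont]) (auto simp: u_def)
        then show "(\<lambda>n. ennreal (\<Psi> (u n z))) \<longlonglongrightarrow> 0"
          using tendsto_ennrealI by fastforce
      qed
    qed auto
    then have "\<forall>\<^sub>F n in sequentially. (\<integral>\<^sup>+ z. ennreal (\<Psi> (u n z)) \<partial>disc_area) < 1"
      by (intro order_tendstoD(2)) auto
    then have "\<forall>\<^sub>F n in sequentially. norm (orlicz_norm \<Psi> (\<lambda>z. f (r n) (\<phi> z) - g (\<phi> z)) - 0) < \<epsilon>"
    proof eventually_elim
      case (elim n)
      then have m: "orlicz_modular \<Psi> (\<lambda>z. (f (r n) (\<phi> z) - g (\<phi> z)) / of_real \<delta>) \<le> 1"
        by (simp add: orlicz_modular_def u_def)
      have "orlicz_norm \<Psi> (\<lambda>z. f (r n) (\<phi> z) - g (\<phi> z)) \<le> \<delta>" using \<delta> m by (intro norm_le)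
      moreover have "0 \<le> orlicz_norm \<Psi> (\<lambda>z. f (r n) (\<phi> z) - g (\<phi> z))"
        using \<delta> m by (intro norm_nonneg) (auto simp: finite_norm_def)
      ultimately show ?case using \<delta> by simp
    qed
    then show "\<exists>n0. \<forall>n\<ge>n0. norm (orlicz_norm \<Psi> (\<lambda>z. f (r n) (\<phi> z) - g (\<phi> z)) - 0) < \<epsilon>"
      by (simp add: eventually_sequentially)
  qed
  ultimately show "\<exists>r g. strict_mono r \<and> g \<in> bergman_orlicz \<Psi> \<and>
      (\<lambda>n. orlicz_norm \<Psi> (\<lambda>z. f (r n) (\<phi> z) - g z)) \<longlonglongrightarrow> 0"
    using gr(2) by blast
qed

subsection \<open>Necessity\<close>

text \<open>The exponent 4 makes the kernel integral of order \<open>(1 - norm b)\<^sup>2\<close>,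
  cancelling \<open>\<Psi>\<close> of the leading coefficient. It also beats that coefficient, of
  order at most \<open>1 / (1 - norm b)\<^sup>2\<close>, at each fixed \<open>z\<close>.\<close>

definition kernel_test :: "complex \<Rightarrow> complex \<Rightarrow> complex" where
  "kernel_test b z = of_real (Inv (1 / (1 - norm b)\<^sup>2)) * (of_real (1 - norm b) / (1 - cnj b * z)) ^ 4"

lemma kernel_test_holomorphic: "norm b < 1 \<Longrightarrow> kernel_test b holomorphic_on ball 0 1"
  unfolding kernel_test_def using one_minus_mult_bounds(2)[of b] by (intro holomorphic_intros) auto

lemma norm_kernel_test:
  "norm b < 1 \<Longrightarrow> norm (kernel_test b z)
    = Inv (1 / (1 - norm b)\<^sup>2) * ((1 - norm b) / norm (1 - cnj b * z)) ^ 4"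
  unfolding kernel_test_def
  by (simp add: norm_mult norm_power norm_divide inv_nonneg del: of_real_diff)

lemma kernel_quotient_le_1:
  "norm b < 1 \<Longrightarrow> norm z < 1 \<Longrightarrow> ((1 - norm b) / norm (1 - cnj b * z)) ^ 4 \<le> 1"
  using one_minus_mult_bounds[of b z] by (intro power_le_one) auto

lemma kernel_test_le:
  assumes "norm b < 1" "norm z < 1"
  shows "norm (kernel_test b z) \<le> Inv (1 / (1 - norm b)\<^sup>2)"
  using kernel_quotient_le_1[OF assms] assms by (simp add: norm_kernel_test mult_left_le inv_nonneg)

text \<open>On the diagonal the quotient equals \<open>1 / (1 + norm b)\<close>, which is at least
  \<open>1/2\<close>; its fourth power gives the 16.\<close>

lemma kernel_test_diag:
  assumes b: "norm b < 1"
  shows "Inv (1 / (1 - norm b)\<^sup>2) / 16 \<le> norm (kernel_test b b)"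
proof -
  have "1 - cnj b * b = of_real ((1 - norm b) * (1 + norm b))"
    using complex_norm_square[of b] by (simp add: algebra_simps power2_eq_square)
  then have "norm (1 - cnj b * b) = (1 - norm b) * (1 + norm b)"
    using b by (simp only: norm_of_real) simp
  then have "(1 - norm b) / norm (1 - cnj b * b) = 1 / (1 + norm b)"
    using b by simp
  moreover have "(1/2) ^ 4 \<le> (1 / (1 + norm b)) ^ 4"
    using b by (intro power_mono frac_le) (auto intro: add_pos_nonneg)
  ultimately have "1/16 \<le> ((1 - norm b) / norm (1 - cnj b * b)) ^ 4" by (simp add: power_divide)
  then have "Inv (1 / (1 - norm b)\<^sup>2) * (1 / 16) \<le> Inv (1 / (1 - norm b)\<^sup>2) * ((1 - norm b) / norm (1 - cnj b * b)) ^ 4"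
    by (intro mult_left_mono inv_nonneg) auto
  then show ?thesis by (simp add: norm_kernel_test b)
qed

text \<open>The quotient's fourth power lies in the unit interval, so \<open>scale_le\<close> pulls
  it out of \<open>\<Psi>\<close>. What remains is \<open>nn_integral_kernel_le\<close>, giving a
  modular at most 22, and scaling by \<open>1/22\<close> brings it to 1.\<close>

lemma kernel_test_norm_le:
  assumes b: "1/2 \<le> norm b" "norm b < 1"
  shows "orlicz_norm \<Psi> (kernel_test b) \<le> 22"
proof (rule norm_le)
  define d where "d = 1 - norm b"
  have d: "d > 0" using b by (simp add: d_def)
  have cont_k: "continuous_on (ball 0 1) (kernel_test b)"
    using kernel_test_holomorphic[OF b(2)] by (rule holomorphic_on_imp_continuous_on)
  have "orlicz_modular \<Psi> (kernel_test b)
      \<le> (\<integral>\<^sup>+ z. ennreal (1 / d\<^sup>2) * ennreal ((d / norm (1 - cnj b * z)) ^ 4) \<partial>disc_area)"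
    unfolding orlicz_modular_def
  proof (rule nn_integral_mono)
    fix z assume "z \<in> space disc_area"
    then have z: "norm z < 1" by simp
    define t where "t = (d / norm (1 - cnj b * z)) ^ 4"
    have t: "0 \<le> t" "t \<le> 1" using kernel_quotient_le_1[OF b(2) z] by (auto simp: t_def d_def)
    have "\<Psi> (norm (kernel_test b z)) = \<Psi> (t * Inv (1 / d\<^sup>2))"
      by (simp add: norm_kernel_test b t_def d_def mult.commute)
    also have "\<dots> \<le> t * \<Psi> (Inv (1 / d\<^sup>2))" using t by (intro scale_le inv_nonneg) auto
    also have "\<dots> = 1 / d\<^sup>2 * t" by simp
    finally show "ennreal (\<Psi> (norm (kernel_test b z))) \<le> ennreal (1 / d\<^sup>2) * ennreal ((d / norm (1 - cnj b * z)) ^ 4)"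
      using t by (simp add: t_def ennreal_leI flip: ennreal_mult)
  qed
  also have "\<dots> = ennreal (1 / d\<^sup>2) * (\<integral>\<^sup>+ z. ennreal ((d / norm (1 - cnj b * z)) ^ 4) \<partial>disc_area)"
    using one_minus_mult_bounds(2)[of b] b
    by (intro nn_integral_cmult measurable_compose[OF measurable_disc_area measurable_ennreal] continuous_intros) auto
  also have "\<dots> \<le> ennreal (1 / d\<^sup>2) * ennreal (22 * d\<^sup>2)"
    using nn_integral_kernel_le[OF b] by (intro mult_left_mono) (auto simp: d_def)
  also have "\<dots> = 22" using d by (simp flip: ennreal_mult)
  finally have le: "orlicz_modular \<Psi> (kernel_test b) \<le> 22" .
  have "orlicz_modular \<Psi> (\<lambda>z. of_real (1/22) * kernel_test b z) \<le> ennreal (1/22) * orlicz_modular \<Psi> (kernel_test b)"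
    by (intro modular_scale cont_k) auto
  also have "\<dots> \<le> ennreal (1/22) * ennreal 22" using le by (intro mult_left_mono) auto
  also have "\<dots> = 1" by (subst ennreal_mult[symmetric]) auto
  finally show "orlicz_modular \<Psi> (\<lambda>z. kernel_test b z / of_real 22) \<le> 1" by simp
qed simp

lemma kernel_test_mem:
  assumes "norm b < 1"
  shows "kernel_test b \<in> bergman_orlicz \<Psi>"
  unfolding mem_bergman_iff using kernel_test_holomorphic[OF assms] kernel_test_le[OF assms]
  by (auto intro!: finite_norm_bounded holomorphic_on_imp_continuous_on)

text \<open>At fixed \<open>z\<close> the denominator stays at least \<open>1 - norm z\<close>. With
  \<open>d = 1 - norm (b n)\<close>, the quotient contributes order \<open>d ^ 4\<close> and the
  coefficient at most order \<open>1 / d\<^sup>2\<close>, leaving order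
  \<open>d\<^sup>2\<close>.\<close>

lemma kernel_test_tendsto_0:
  assumes b: "\<And>n. norm (b n) < 1" "(\<lambda>n. norm (b n)) \<longlonglongrightarrow> 1" and z: "norm z < 1"
  shows "(\<lambda>n. kernel_test (b n) z) \<longlonglongrightarrow> 0"
proof -
  obtain K where K: "K \<ge> 0" "\<And>y. y \<ge> 0 \<Longrightarrow> Inv y \<le> max K y" using inv_le_max by blast
  define c where "c = (K + 1) / (1 - norm z) ^ 4"
  have "norm (kernel_test (b n) z) \<le> c * (1 - norm (b n))\<^sup>2" for n
  proof -
    define d where "d = 1 - norm (b n)"
    have d: "0 < d" "d \<le> 1" using b(1)[of n] by (auto simp: d_def)
    have "norm (b n) * norm z \<le> norm z" using b(1)[of n] by (intro mult_left_le_one_le) auto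
    then have "1 - norm z \<le> norm (1 - cnj (b n) * z)"
      using norm_triangle_ineq2[of 1 "cnj (b n) * z"] by (simp add: norm_mult)
    then have "d / norm (1 - cnj (b n) * z) \<le> d / (1 - norm z)"
      using d z by (intro divide_left_mono) (auto intro!: mult_pos_pos)
    then have "(d / norm (1 - cnj (b n) * z)) ^ 4 \<le> (d / (1 - norm z)) ^ 4"
      using d by (intro power_mono) auto
    moreover have "Inv (1 / d\<^sup>2) \<le> (K + 1) / d\<^sup>2"
    proof -
      have d2: "d\<^sup>2 \<le> 1" using d by (simp add: power_le_one)
      have "Inv (1 / d\<^sup>2) \<le> max K (1 / d\<^sup>2)" by (rule K) auto
      also have "\<dots> \<le> (K + 1) / d\<^sup>2"
        using K(1) d d2 mult_left_mono[OF d2 K(1)] by (auto simp: field_simps)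
      finally show ?thesis .
    qed
    ultimately have "norm (kernel_test (b n) z) \<le> (K + 1) / d\<^sup>2 * (d / (1 - norm z)) ^ 4"
      unfolding norm_kernel_test[OF b(1)] d_def[symmetric]
      using K d by (intro mult_mono) auto
    also have "\<dots> = c * d\<^sup>2"
    proof -
      have *: "d ^ 4 = d\<^sup>2 * d\<^sup>2" by (simp flip: power_add)
      have "(K + 1) / p * (p * p / q) = (K + 1) / q * p" if "p \<noteq> 0" for p q :: real
        using that by simp
      from this[of "d\<^sup>2"] show ?thesis using d unfolding c_def power_divide * by simp
    qed
    finally show ?thesis by (simp add: d_def)
  qed
  then have "\<forall>\<^sub>F n in sequentially. norm (kernel_test (b n) z) \<le> c * (1 - norm (b n))\<^sup>2"
    by simp
  moreover have "(\<lambda>n. c * (1 - norm (b n))\<^sup>2) \<longlonglongrightarrow> c * (1 - 1)\<^sup>2"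
    by (intro tendsto_intros b)
  then have "(\<lambda>n. c * (1 - norm (b n))\<^sup>2) \<longlonglongrightarrow> 0"
    by simp
  ultimately show ?thesis by (rule Lim_null_comparison)
qed

section \<open>The contradiction along a sequence of bad points\<close>

lemma limit_if_compact_composition:
  assumes \<phi>: "\<phi> holomorphic_on ball 0 1" "\<phi> ` ball 0 1 \<subseteq> ball 0 1"
    and comp: "compact_composition \<Psi> \<phi>"
  shows "((\<lambda>a. Inv (1 / (1 - norm (\<phi> a))\<^sup>2) / Inv (1 / (1 - norm a)\<^sup>2)) \<longlongrightarrow> 0) near_circle"
proof (rule ccontr)
  define H where "H = (\<lambda>z::complex. Inv (1 / (1 - norm z)\<^sup>2))"
  have Hpos: "0 < H z" if "norm z < 1" for z using that by (auto simp: H_def intro!: inv_pos)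
  have \<phi>in: "norm (\<phi> z) < 1" if "norm z < 1" for z using that \<phi>(2) by (auto simp: image_subset_iff)
  assume "\<not> ((\<lambda>a. Inv (1 / (1 - norm (\<phi> a))\<^sup>2) / Inv (1 / (1 - norm a)\<^sup>2)) \<longlongrightarrow> 0) near_circle"
  then obtain \<epsilon> where \<epsilon>: "\<epsilon> > 0" "\<not> (\<forall>\<^sub>F a in near_circle. norm (H (\<phi> a) / H a) < \<epsilon>)"
    by (auto simp: tendsto_iff H_def)
  have Hlim: "filterlim H at_top near_circle"
    unfolding H_def by (intro filterlim_compose[OF inv_at_top] filterlim_inverse_square_near_circle)
  \<comment> \<open>Failure of the limit gives points near the circle with
    \<open>\<epsilon> * H a \<le> H (\<phi> a)\<close>. As \<open>H a\<close> is large there, so is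
    \<open>H (\<phi> a)\<close>, which forces \<open>\<phi> a\<close> out of any smaller
    disc.\<close>
  have "\<exists>a. norm a < 1 \<and> s < norm (\<phi> a) \<and> \<epsilon> * H a \<le> H (\<phi> a)" if s: "s < 1" for s
  proof -
    have "\<forall>\<^sub>F a in near_circle. Inv (1 / (1 - s)\<^sup>2) / \<epsilon> < H a"
      using Hlim by (simp add: filterlim_at_top_dense)
    then obtain t where t: "t < 1" "\<And>a. t < norm a \<Longrightarrow> norm a < 1 \<Longrightarrow> Inv (1 / (1 - s)\<^sup>2) / \<epsilon> < H a"
      unfolding eventually_near_circle by blast
    obtain a where a: "t < norm a" "norm a < 1" "\<epsilon> \<le> norm (H (\<phi> a) / H a)"
      using \<epsilon>(2) t(1) unfolding eventually_near_circle by (meson not_le)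
    have le: "\<epsilon> * H a \<le> H (\<phi> a)"
      using a(3) Hpos[OF a(2)] Hpos[OF \<phi>in[OF a(2)]] by (simp add: field_simps)
    have "Inv (1 / (1 - s)\<^sup>2) < H (\<phi> a)"
      using t(2)[OF a(1,2)] \<epsilon> le by (simp add: field_simps)
    then have "s < norm (\<phi> a)"
      using inv_disc_mono[of "norm (\<phi> a)" s] s by (auto simp: H_def not_less[symmetric])
    then show ?thesis using a le by blast
  qed
  \<comment> \<open>The shift by 2 keeps \<open>norm (\<phi> a)\<close> at least \<open>1/2\<close>
    already for \<open>n = 0\<close>, as \<open>kernel_test_norm_le\<close> requires.\<close>
  then have "\<forall>n. \<exists>a. norm a < 1 \<and> 1 - 1 / real (n + 2) < norm (\<phi> a) \<and> \<epsilon> * H a \<le> H (\<phi> a)"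
    by simp
  from choice[OF this] obtain a where a: "\<And>n. norm (a n) < 1"
    "\<And>n. 1 - 1 / real (n + 2) < norm (\<phi> (a n))" "\<And>n. \<epsilon> * H (a n) \<le> H (\<phi> (a n))"
    by blast
  define b where "b n = \<phi> (a n)" for n
  have b1: "norm (b n) < 1" for n using a(1) \<phi>in by (simp add: b_def)
  have b2: "1/2 \<le> norm (b n)" for n
  proof -
    have "1 / real (n + 2) \<le> 1 / 2" by (simp add: field_simps)
    then show ?thesis using a(2)[of n] unfolding b_def by linarith
  qed
  have blim: "(\<lambda>n. norm (b n)) \<longlonglongrightarrow> 1"
  proof (rule tendsto_sandwich[of "\<lambda>n. 1 - 1 / real (n + 2)" _ _ "\<lambda>_. 1"])
    show "(\<lambda>n. 1 - 1 / real (n + 2)) \<longlonglongrightarrow> 1" by real_asymp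
  qed (use a(2) b1 in \<open>auto simp: b_def less_imp_le intro!: always_eventually\<close>)
  obtain r g where r: "strict_mono (r :: nat \<Rightarrow> nat)" and g: "g \<in> bergman_orlicz \<Psi>"
    and lim: "(\<lambda>n. orlicz_norm \<Psi> (\<lambda>z. kernel_test (b (r n)) (\<phi> z) - g z)) \<longlonglongrightarrow> 0"
    using comp[unfolded compact_composition_def, rule_format, of "\<lambda>n. kernel_test (b n)"]
      kernel_test_mem[OF b1] kernel_test_norm_le[OF b2 b1] by blast
  define N where "N n = orlicz_norm \<Psi> (\<lambda>z. kernel_test (b (r n)) (\<phi> z) - g z)" for n
  have ghol: "g holomorphic_on ball 0 1" and gfin: "finite_norm g" using g by (auto simp: mem_bergman_iff)
  have kc: "(\<lambda>z. kernel_test (b n) (\<phi> z)) holomorphic_on ball 0 1" for n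
    using holomorphic_on_compose_gen[OF \<phi>(1) kernel_test_holomorphic[OF b1] \<phi>(2)] by (simp add: o_def)
  \<comment> \<open>Each composed test function is bounded, so its norm is a genuine infimum and the
    pointwise bound applies to the difference with \<open>g\<close>.\<close>
  have kfin: "finite_norm (\<lambda>z. kernel_test (b n) (\<phi> z))" for n
    using kernel_test_le[OF b1] \<phi>in kc
    by (intro finite_norm_bounded[where B = "Inv (1 / (1 - norm (b n))\<^sup>2)"] holomorphic_on_imp_continuous_on) auto
  have pt: "norm (kernel_test (b (r n)) (\<phi> z) - g z) \<le> N n * H z" if "norm z < 1" for n z
    unfolding N_def H_def using that kc kfin ghol gfin
    by (intro pointwise_norm_bound[where f = "\<lambda>z. kernel_test (b (r n)) (\<phi> z) - g z"]
        holomorphic_intros finite_norm_diff holomorphic_on_imp_continuous_on)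
  have Nlim: "N \<longlonglongrightarrow> 0" using lim by (simp add: N_def[abs_def])
  \<comment> \<open>Norm convergence implies pointwise convergence to \<open>g\<close>, while the
    test functions tend to 0 at the fixed point \<open>\<phi> z\<close>.\<close>
  have g0: "g z = 0" if z: "norm z < 1" for z
  proof -
    have "(\<lambda>n. N n * H z) \<longlonglongrightarrow> 0" using tendsto_mult_left_zero[OF Nlim] .
    then have "(\<lambda>n. kernel_test (b (r n)) (\<phi> z) - g z) \<longlonglongrightarrow> 0"
      by (rule Lim_null_comparison[rotated]) (use pt[OF z] in auto)
    moreover have "(\<lambda>n. kernel_test (b (r n)) (\<phi> z)) \<longlonglongrightarrow> 0"
      using kernel_test_tendsto_0[OF b1 blim \<phi>in[OF z]] LIMSEQ_subseq_LIMSEQ[OF _ r] by (force simp: o_def)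
    then have "(\<lambda>n. kernel_test (b (r n)) (\<phi> z) - g z) \<longlonglongrightarrow> 0 - g z"
      by (intro tendsto_intros)
    ultimately show ?thesis using LIMSEQ_unique by fastforce
  qed
  \<comment> \<open>At the bad point \<open>a (r n)\<close> the test function is evaluated on its
    own diagonal, so its size is at least \<open>H (\<phi> x) / 16\<close>; the pointwise bound
    transfers this to the norm, which therefore cannot tend to 0.\<close>
  have "\<epsilon> / 16 \<le> N n" for n
  proof -
    define x where "x = a (r n)"
    have x: "norm x < 1" "b (r n) = \<phi> x" using a(1) by (auto simp: x_def b_def)
    have "\<epsilon> * H x / 16 \<le> H (\<phi> x) / 16" using a(3) by (simp add: x_def)
    also have "\<dots> \<le> norm (kernel_test (b (r n)) (\<phi> x))"
      using kernel_test_diag[OF b1, of "r n"] by (simp add: x(2) H_def)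
    also have "\<dots> \<le> N n * H x" using pt[OF x(1), of n] g0[OF x(1)] by simp
    finally have "\<epsilon> / 16 * H x \<le> N n * H x" by simp
    then show ?thesis using Hpos[OF x(1)] by (simp only: mult_le_cancel_right_pos)
  qed
  then have "\<epsilon> / 16 \<le> 0" using Nlim by (intro tendsto_lowerbound[OF Nlim]) auto
  then show False using \<epsilon> by simp
qed

end

theorem mainTheorem19:
  fixes \<Psi> :: "real \<Rightarrow> real" and \<phi> :: "complex \<Rightarrow> complex"
  assumes "orlicz_function \<Psi>"
    and "\<phi> holomorphic_on ball 0 1" and "\<phi> ` ball 0 1 \<subseteq> ball 0 1"
  shows "(compact_composition \<Psi> \<phi> \<longrightarrow>
           ((\<lambda>a. orlicz_inv \<Psi> (1 / (1 - norm (\<phi> a))\<^sup>2) / orlicz_inv \<Psi> (1 / (1 - norm a)\<^sup>2))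
              \<longlongrightarrow> 0) (filtercomap norm (at_left 1)))
       \<and> (Delta2 \<Psi> \<and>
           ((\<lambda>a. orlicz_inv \<Psi> (1 / (1 - norm (\<phi> a))\<^sup>2) / orlicz_inv \<Psi> (1 / (1 - norm a)\<^sup>2))
              \<longlongrightarrow> 0) (filtercomap norm (at_left 1))
           \<longrightarrow> compact_composition \<Psi> \<phi>)"
proof -
  interpret orlicz \<Psi> by unfold_locales (rule assms(1))
  show ?thesis
    using limit_if_compact_composition[OF assms(2,3)] compact_composition_if[OF assms(2,3)] by blast
qed

end
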